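(* Let $\Delta\ge 3$ and let $F$ be a dynamic rooted forest of maximum degree at most $\Delta$, initially empty, undergoing insertions and deletions. The algorithm {\textsc{ColorfulPath}} maintains a proper edge coloring of $F$ with $2\Delta-2$ colors with amortized recourse $O(1)$. This is optimal up to a constant factor: for every deterministic algorithm maintaining a proper $(2\Delta-2)$-edge-coloring of such a rooted forest and all sufficiently large $n$, there are update sequences on which its amortized recourse is $\Omega(1)$.
   Context: A dynamic rooted forest is a collection of trees on a fixed vertex set, each with an assigned root; initially there are no edges and every vertex is a root. An insertion has the form $(p,r)$ where $r$ is the root of its tree and $p$ lies in a different tree; $r$ becomes a child of $p$. A deletion of an edge $(u,v)$, where $u$ is the parent of $v$, makes $v$ the root of the newly created tree. The maximum degree always stays at most $\Delta$. The palette is $[\kappa]$ with $\kappa=2\Delta-2$; for a vertex $x$, $A(x)$ denotes the set of colors not used on edges incident to $x$. Recourse of an update is the number of previously colored edges whose color changes (coloring a new edge does not count); amortized recourse is total recourse divided by the number of updates. {\textsc{ColorfulPath}}: on deletion, delete the edge and keep the coloring. On insertion of $(p,r)$, add it uncolored and call Step$((p,r),p)$, where Step$(e=(u,v),u)$ for an uncolored edge $e$ with $v$ a child of $u$ does: (1) if $A(u)\cap A(v)\neq\emptyset$, color $e$ by any color in it and stop; (2) else, if some child $w$ of $v$ satisfies $\mathrm{color}(v,w)\in A(u)$ and $A(w)\cap A(v)\ne\emptyset$, color $e$ by $\mathrm{color}(v,w)$, uncolor $(v,w)$ and call Step$((v,w),v)$; (3) otherwise, let $\beta$ be the color of the edge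 from the grandparent of $u$ to the parent of $u$ if that edge exists (else $\beta$ is null), choose an arbitrary child $w$ of $v$ with $\mathrm{color}(v,w)\ne\beta$, color $e$ by $\mathrm{color}(v,w)$, uncolor $(v,w)$, and call Step$((v,w),v)$. *)

theory Defs
  imports Complex_Main
begin

section \<open>Dynamic rooted forests\<close>

text \<open>A rooted forest on a vertex set is given by its set of edges, each written as the pair
  (parent, child).\<close>

type_synonym 'v edge = "'v \<times> 'v"

datatype 'v update = Insert 'v 'v | Delete 'v 'v

definition incident :: "'v \<Rightarrow> 'v edge \<Rightarrow> bool" where
  "incident x e \<longleftrightarrow> fst e = x \<or> snd e = x"

definition degree :: "'v edge set \<Rightarrow> 'v \<Rightarrow> nat" where
  "degree E x = card {e \<in> E. incident x e}"

definition is_root :: "'v edge set \<Rightarrow> 'v \<Rightarrow> bool" where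
  "is_root E r \<longleftrightarrow> (\<nexists>p. (p, r) \<in> E)"

definition same_tree :: "'v edge set \<Rightarrow> 'v \<Rightarrow> 'v \<Rightarrow> bool" where
  "same_tree E x y \<longleftrightarrow> (x, y) \<in> (E \<union> E\<inverse>)\<^sup>*"

fun apply_update :: "'v edge set \<Rightarrow> 'v update \<Rightarrow> 'v edge set" where
  "apply_update E (Insert p r) = insert (p, r) E"
| "apply_update E (Delete u v) = E - {(u, v)}"

definition forest_of :: "'v update list \<Rightarrow> 'v edge set" where
  "forest_of \<sigma> = foldl apply_update {} \<sigma>"

fun admissible :: "'v set \<Rightarrow> 'v edge set \<Rightarrow> 'v update \<Rightarrow> bool" where
  "admissible V E (Insert p r) \<longleftrightarrow> p \<in> V \<and> r \<in> V \<and> is_root E r \<and> \<not> same_tree E p r"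
| "admissible V E (Delete u v) \<longleftrightarrow> (u, v) \<in> E"

definition legal_sequence :: "nat \<Rightarrow> 'v set \<Rightarrow> 'v update list \<Rightarrow> bool" where
  "legal_sequence \<Delta> V \<sigma> \<longleftrightarrow>
     (\<forall>i < length \<sigma>. admissible V (forest_of (take i \<sigma>)) (\<sigma> ! i) \<and>
        (\<forall>x \<in> V. degree (forest_of (take (Suc i) \<sigma>)) x \<le> \<Delta>))"


section \<open>Edge colorings and recourse\<close>

text \<open>A partial map: an edge is mapped to \<open>None\<close> iff it is uncolored or absent.\<close>

type_synonym 'v coloring = "'v edge \<Rightarrow> nat option"

definition proper_edge_coloring :: "nat \<Rightarrow> 'v edge set \<Rightarrow> 'v coloring \<Rightarrow> bool" where
  "proper_edge_coloring \<kappa> E c \<longleftrightarrow> dom c = E \<and> ran c \<subseteq> {1..\<kappa>} \<and>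
     (\<forall>x. \<forall>e \<in> E. \<forall>f \<in> E. incident x e \<and> incident x f \<and> e \<noteq> f \<longrightarrow> c e \<noteq> c f)"

text \<open>Edges inserted or deleted by the update lie in only one of the two domains, so they do
  not count.\<close>

definition recourse :: "'v coloring \<Rightarrow> 'v coloring \<Rightarrow> nat" where
  "recourse c c' = card {e \<in> dom c \<inter> dom c'. c e \<noteq> c' e}"

text \<open>Here \<open>\<gamma> i\<close> is the coloring after the first \<open>i\<close> updates, and \<open>m\<close> is the number of
  updates.\<close>

definition amortized_recourse :: "nat \<Rightarrow> (nat \<Rightarrow> 'v coloring) \<Rightarrow> real" where
  "amortized_recourse m \<gamma> = real (\<Sum>i<m. recourse (\<gamma> i) (\<gamma> (Suc i))) / real m"


section \<open>The algorithm ColorfulPath\<close>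

text \<open>The set \<open>A(x)\<close>, with respect to the current coloring.\<close>

definition available :: "nat \<Rightarrow> 'v coloring \<Rightarrow> 'v \<Rightarrow> nat set" where
  "available \<kappa> c x = {1..\<kappa>} - {k. \<exists>e. incident x e \<and> c e = Some k}"

text \<open>\<open>Step c u v\<close> is a pending call Step((u,v),u) with current coloring \<open>c\<close>; \<open>Stop c\<close> means
  that the procedure has stopped with coloring \<open>c\<close>. The transitions are nondeterministic, which
  models the arbitrary choices of the algorithm.\<close>

datatype 'v config = Step "'v coloring" 'v 'v | Stop "'v coloring"

definition good_child :: "nat \<Rightarrow> 'v edge set \<Rightarrow> 'v coloring \<Rightarrow> 'v \<Rightarrow> 'v \<Rightarrow> 'v \<Rightarrow> bool" where
  "good_child \<kappa> E c u v w \<longleftrightarrow> (v, w) \<in> E \<and>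
     (\<exists>k \<in> available \<kappa> c u. c (v, w) = Some k) \<and> available \<kappa> c w \<inter> available \<kappa> c v \<noteq> {}"

text \<open>In the third rule, the condition on \<open>g\<close> and \<open>x\<close> says \<open>color(v,w) \<noteq> \<beta>\<close>: \<open>x\<close> is the parent of
  \<open>u\<close> and \<open>g\<close> the parent of \<open>x\<close>, and there is no condition if one of them does not exist.\<close>

inductive cp_step :: "nat \<Rightarrow> 'v edge set \<Rightarrow> 'v config \<Rightarrow> 'v config \<Rightarrow> bool"
  for \<kappa> :: nat and E :: "'v edge set" where
  common_color:
    "k \<in> available \<kappa> c u \<inter> available \<kappa> c v \<Longrightarrow>
     cp_step \<kappa> E (Step c u v) (Stop (c((u, v) \<mapsto> k)))"
| shift_good:
    "available \<kappa> c u \<inter> available \<kappa> c v = {} \<Longrightarrow> good_child \<kappa> E c u v w \<Longrightarrow>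
     cp_step \<kappa> E (Step c u v) (Step (c((u, v) := c (v, w), (v, w) := None)) v w)"
| shift_other:
    "available \<kappa> c u \<inter> available \<kappa> c v = {} \<Longrightarrow> \<nexists>w'. good_child \<kappa> E c u v w' \<Longrightarrow>
     (v, w) \<in> E \<Longrightarrow> (\<And>g x. (x, u) \<in> E \<Longrightarrow> (g, x) \<in> E \<Longrightarrow> c (v, w) \<noteq> c (g, x)) \<Longrightarrow>
     cp_step \<kappa> E (Step c u v) (Step (c((u, v) := c (v, w), (v, w) := None)) v w)"

text \<open>\<open>E\<close> and \<open>c\<close> are the forest and the coloring before the update.\<close>

fun cp_update :: "nat \<Rightarrow> 'v edge set \<Rightarrow> 'v update \<Rightarrow> 'v coloring \<Rightarrow> 'v coloring \<Rightarrow> bool" where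
  "cp_update \<kappa> E (Insert p r) c c' \<longleftrightarrow>
     (cp_step \<kappa> (insert (p, r) E))\<^sup>*\<^sup>* (Step (c((p, r) := None)) p r) (Stop c')"
| "cp_update \<kappa> E (Delete u v) c c' \<longleftrightarrow> c' = c((u, v) := None)"

text \<open>No execution of the update goes on forever, and none gets stuck in a pending call. This
  is needed besides \<open>cp_update\<close>, which speaks only about executions that stop.\<close>

fun cp_terminates :: "nat \<Rightarrow> 'v edge set \<Rightarrow> 'v update \<Rightarrow> 'v coloring \<Rightarrow> bool" where
  "cp_terminates \<kappa> E (Insert p r) c \<longleftrightarrow>
     (let R = cp_step \<kappa> (insert (p, r) E); s = Step (c((p, r) := None)) p r in
        termip R s \<and> (\<forall>s'. R\<^sup>*\<^sup>* s s' \<and> (\<nexists>s''. R s' s'') \<longrightarrow> (\<exists>c'. s' = Stop c')))"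
| "cp_terminates \<kappa> E (Delete u v) c \<longleftrightarrow> True"

definition cp_run :: "nat \<Rightarrow> 'v update list \<Rightarrow> (nat \<Rightarrow> 'v coloring) \<Rightarrow> bool" where
  "cp_run \<kappa> \<sigma> \<gamma> \<longleftrightarrow> \<gamma> 0 = Map.empty \<and>
     (\<forall>i < length \<sigma>. cp_update \<kappa> (forest_of (take i \<sigma>)) (\<sigma> ! i) (\<gamma> i) (\<gamma> (Suc i)))"

text \<open>Termination of the \<open>i\<close>-th update is claimed for every execution of the first \<open>i\<close> updates,
  whether or not it can be completed to one of all of \<open>\<sigma>\<close>.\<close>

definition cp_maintains_proper :: "nat \<Rightarrow> 'v update list \<Rightarrow> bool" where
  "cp_maintains_proper \<kappa> \<sigma> \<longleftrightarrow>
     (\<forall>\<gamma>. \<forall>i \<le> length \<sigma>. cp_run \<kappa> (take i \<sigma>) \<gamma> \<longrightarrow>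
        proper_edge_coloring \<kappa> (forest_of (take i \<sigma>)) (\<gamma> i) \<and>
        (i < length \<sigma> \<longrightarrow> cp_terminates \<kappa> (forest_of (take i \<sigma>)) (\<sigma> ! i) (\<gamma> i)))"


section \<open>Deterministic algorithms\<close>

text \<open>The output of a deterministic online algorithm is a function of the updates seen so far.\<close>

type_synonym 'v det_algorithm = "'v update list \<Rightarrow> 'v coloring"

definition maintains_proper :: "nat \<Rightarrow> nat \<Rightarrow> 'v set \<Rightarrow> 'v det_algorithm \<Rightarrow> bool" where
  "maintains_proper \<kappa> \<Delta> V alg \<longleftrightarrow>
     (\<forall>\<sigma>. legal_sequence \<Delta> V \<sigma> \<longrightarrow> proper_edge_coloring \<kappa> (forest_of \<sigma>) (alg \<sigma>))"

end

theory Submission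
  imports Defs
begin

text \<open>Upper bound. If the pending edge \<open>(u, v)\<close> has no free color, then counting shows that the
  colors of the child edges of \<open>v\<close> are exactly \<open>A(u)\<close>. If moreover no child of \<open>v\<close> is good, then
  every child of \<open>v\<close> uses on its child edges exactly the colors that \<open>v\<close> does not use on its own;
  call such a vertex \<open>v\<close> tight. The shift makes \<open>v\<close> non-tight, and at most the parent of \<open>u\<close> can
  become tight, which the choice of a color different from \<open>\<beta>\<close> excludes in all but the
  first two shifts. So the number of tight vertices is a potential that pays for all but
  a bounded number of shifts per update, and an update creates a bounded number of tight vertices.

  Lower bound. The adversary keeps many stars with \<open>\<Delta> - 1\<close> leaves and a hub. It picks a set \<open>X\<close>
  of colors used by many stars and attaches such stars to the hub. The hub edges must avoid
  \<open>X\<close>, so at most \<open>\<Delta> - 1\<close> of them coexist, and the algorithm has to recolor. A star whose color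
  set has changed is detached again, and \<open>X\<close> is replaced once no unattached star uses it. The
  stars themselves are never rebuilt.\<close>

section \<open>Partial colorings\<close>

text \<open>The edge set is left out, so that the notion also applies while one edge of the forest
  is uncolored.\<close>

definition partial_proper :: "nat \<Rightarrow> 'v coloring \<Rightarrow> bool" where
  "partial_proper \<kappa> c \<longleftrightarrow> ran c \<subseteq> {1..\<kappa>} \<and>
     (\<forall>x e f k. incident x e \<longrightarrow> incident x f \<longrightarrow> c e = Some k \<longrightarrow> c f = Some k \<longrightarrow> e = f)"

definition used_colors :: "'v coloring \<Rightarrow> 'v \<Rightarrow> nat set" where
  "used_colors c x = {k. \<exists>e. incident x e \<and> c e = Some k}"

definition child_colors :: "'v coloring \<Rightarrow> 'v \<Rightarrow> nat set" where
  "child_colors c x = {k. \<exists>y. c (x, y) = Some k}"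

lemma proper_edge_coloring_iff:
  "proper_edge_coloring \<kappa> E c \<longleftrightarrow> dom c = E \<and> partial_proper \<kappa> c"
  unfolding proper_edge_coloring_def partial_proper_def
  by (intro conj_cong refl) (metis domD domI)

lemma available_eq: "available \<kappa> c x = {1..\<kappa>} - used_colors c x"
  by (simp add: available_def used_colors_def)

lemma partial_proper_range: "partial_proper \<kappa> c \<Longrightarrow> c e = Some k \<Longrightarrow> k \<in> {1..\<kappa>}"
  unfolding partial_proper_def by (metis ranI subsetD)

lemma partial_proper_unique:
  "partial_proper \<kappa> c \<Longrightarrow> incident x e \<Longrightarrow> incident x f \<Longrightarrow> c e = Some k \<Longrightarrow> c f = Some k \<Longrightarrow> e = f"
  unfolding partial_proper_def by blast

lemma used_colors_subset: "partial_proper \<kappa> c \<Longrightarrow> used_colors c x \<subseteq> {1..\<kappa>}"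
  unfolding used_colors_def using partial_proper_range by blast

lemma child_colors_subset_used: "child_colors c x \<subseteq> used_colors c x"
  unfolding child_colors_def used_colors_def incident_def by fastforce

lemma finite_used_colors: "partial_proper \<kappa> c \<Longrightarrow> finite (used_colors c x)"
  by (meson finite_subset finite_atLeastAtMost used_colors_subset)

lemma finite_child_colors: "partial_proper \<kappa> c \<Longrightarrow> finite (child_colors c x)"
  by (rule finite_subset[OF child_colors_subset_used finite_used_colors])

lemma partial_proper_upd:
  assumes "partial_proper \<kappa> c" "k \<in> available \<kappa> c u" "k \<in> available \<kappa> c v"
  shows "partial_proper \<kappa> (c((u, v) \<mapsto> k))"
proof -
  have "c e \<noteq> Some k" if "incident x e" "incident x (u, v)" for x e
    using assms(2,3) that unfolding available_def incident_def by fastforce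
  moreover have "ran (c((u, v) \<mapsto> k)) \<subseteq> {1..\<kappa>}"
    using assms partial_proper_range[OF assms(1)] unfolding available_def ran_def by auto
  ultimately show ?thesis
    using assms(1) unfolding partial_proper_def by (auto split: if_splits)
qed

lemma partial_proper_uncolor: "partial_proper \<kappa> c \<Longrightarrow> partial_proper \<kappa> (c(e := None))"
  unfolding partial_proper_def ran_def by (auto split: if_splits)

lemma partial_proper_empty: "partial_proper \<kappa> Map.empty"
  unfolding partial_proper_def by simp

section \<open>Tight vertices and the potential\<close>

definition tight :: "nat \<Rightarrow> 'v coloring \<Rightarrow> 'v \<Rightarrow> bool" where
  "tight \<Delta> c x \<longleftrightarrow> card (child_colors c x) = \<Delta> - 1 \<and>
     (\<forall>y. c (x, y) \<noteq> None \<longrightarrow> child_colors c y = {1..2 * \<Delta> - 2} - child_colors c x)"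

definition potential :: "nat \<Rightarrow> 'v coloring \<Rightarrow> nat" where
  "potential \<Delta> c = card {x. tight \<Delta> c x}"

text \<open>The cardinality clause of \<open>tight\<close> provides a colored child edge, so tight
  vertices are parents of colored edges. Finiteness matters because \<open>card\<close> of an
  infinite set is 0.\<close>

lemma finite_tight:
  assumes "\<Delta> \<ge> 2" "finite (dom c)"
  shows "finite {x. tight \<Delta> c x}"
proof (rule finite_subset)
  show "{x. tight \<Delta> c x} \<subseteq> fst ` dom c"
  proof
    fix x assume "x \<in> {x. tight \<Delta> c x}"
    then have "card (child_colors c x) \<noteq> 0" using assms by (simp add: tight_def)
    then have "child_colors c x \<noteq> {}" by auto
    then show "x \<in> fst ` dom c" unfolding child_colors_def by (force simp: dom_def image_iff)
  qed
qed (use assms in simp)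

text \<open>Tightness of \<open>y\<close> depends only on the child edges of \<open>y\<close> and of
  its children. So a change confined to the child edges of \<open>U\<close> can create tight
  vertices only in \<open>U\<close> and among the parents of \<open>U\<close>.\<close>

lemma tight_local:
  assumes "\<And>z y. z \<notin> U \<Longrightarrow> c' (z, y) = c (z, y)" and "dom c' \<subseteq> E" and "tight \<Delta> c' y"
  shows "tight \<Delta> c y \<or> y \<in> U \<or> (\<exists>z\<in>U. (y, z) \<in> E)"
proof -
  have *: "child_colors c' z = child_colors c z" if "z \<notin> U" for z
    using assms(1)[OF that] by (simp add: child_colors_def)
  have "tight \<Delta> c y" if y: "y \<notin> U" and n: "\<forall>z\<in>U. (y, z) \<notin> E"
    unfolding tight_def
  proof (intro conjI allI impI)
    show "card (child_colors c y) = \<Delta> - 1"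
      using assms(3) *[OF y] by (simp add: tight_def)
    fix z assume "c (y, z) \<noteq> None"
    then have z: "c' (y, z) \<noteq> None" using assms(1)[OF y] by simp
    then have "z \<notin> U" using n assms(2) by blast
    then show "child_colors c z = {1..2 * \<Delta> - 2} - child_colors c y"
      using assms(3) z *[OF y] *[of z] by (simp add: tight_def)
  qed
  then show ?thesis by blast
qed


abbreviation shift :: "'v coloring \<Rightarrow> 'v \<Rightarrow> 'v \<Rightarrow> 'v \<Rightarrow> 'v coloring" where
  "shift c u v w \<equiv> c((u, v) := c (v, w), (v, w) := None)"

text \<open>In contrast to \<open>recourse\<close>, an edge of \<open>c0\<close> that is momentarily
  uncolored counts already. So an edge is charged when a shift uncolors it, and coloring the pending
  edge afterwards costs nothing.\<close>

definition changed :: "'v coloring \<Rightarrow> 'v coloring \<Rightarrow> 'v edge set" where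
  "changed c0 c = {e \<in> dom c0. c e \<noteq> c0 e}"

lemma card_changed_shift:
  assumes "finite (dom c0)" "c (u, v) = None"
  shows "card (changed c0 (shift c u v w)) \<le> Suc (card (changed c0 c))"
proof -
  have fin: "finite (changed c0 c)" using assms(1) unfolding changed_def by simp
  have "changed c0 (shift c u v w) \<subseteq> insert (v, w) (changed c0 c)"
    using assms(2) unfolding changed_def by auto
  then have "card (changed c0 (shift c u v w)) \<le> card (insert (v, w) (changed c0 c))"
    using fin by (intro card_mono) auto
  then show ?thesis using fin by (metis card_insert_if le_SucI)
qed

lemma card_changed_color:
  assumes "finite (dom c0)" "c (u, v) = None"
  shows "card (changed c0 (c((u, v) \<mapsto> k))) \<le> card (changed c0 c)"
  using assms unfolding changed_def by (intro card_mono) auto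


section \<open>One update of ColorfulPath\<close>

text \<open>For an insertion, \<open>E\<close> is the forest that already contains the new edge; for
  a deletion, it is the forest before the update.\<close>

locale bounded_forest =
  fixes \<Delta> :: nat and E :: "'v edge set"
  assumes Delta: "\<Delta> \<ge> 3"
    and finite_edges: "finite E"
    and acyclic_edges: "acyclic E"
    and parent_unique: "(x, v) \<in> E \<Longrightarrow> (y, v) \<in> E \<Longrightarrow> x = y"
    and degree_le: "degree E x \<le> \<Delta>"
begin

abbreviation "\<kappa> \<equiv> 2 * \<Delta> - 2"

definition pending :: "'v coloring \<Rightarrow> 'v \<Rightarrow> 'v \<Rightarrow> bool" where
  "pending c u v \<longleftrightarrow> (u, v) \<in> E \<and> dom c = E - {(u, v)} \<and> partial_proper \<kappa> c"

lemma irrefl_edge: "(x, x) \<notin> E"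
  using acyclic_edges unfolding acyclic_def by blast

lemma antisym_edge: "(x, y) \<in> E \<Longrightarrow> (y, x) \<notin> E"
  using acyclic_edges unfolding acyclic_def by (meson trancl.simps)

lemma no_triangle: "(x, y) \<in> E \<Longrightarrow> (y, z) \<in> E \<Longrightarrow> (z, x) \<notin> E"
  using acyclic_edges unfolding acyclic_def by (meson trancl.simps)

text \<open>\<open>F\<close> stands for edges at \<open>x\<close> known to be uncolored: it is
  \<open>{(u, v)}\<close> for the endpoints of the pending edge and empty for a child of
  \<open>v\<close>.\<close>

lemma card_used_le:
  assumes "dom c \<subseteq> E - F" "F \<subseteq> {e \<in> E. incident x e}"
  shows "card (used_colors c x) \<le> \<Delta> - card F"
proof -
  have fin: "finite {e \<in> E. incident x e}" using finite_edges by simp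
  have "used_colors c x \<subseteq> (\<lambda>e. the (c e)) ` ({e \<in> E. incident x e} - F)"
    using assms(1) unfolding used_colors_def image_def by (force simp: dom_def)
  then have "card (used_colors c x) \<le> card ({e \<in> E. incident x e} - F)"
    using fin by (intro surj_card_le) auto
  also have "\<dots> = degree E x - card F"
    using assms(2) fin unfolding degree_def by (simp add: card_Diff_subset finite_subset)
  finally show ?thesis using degree_le[of x] by linarith
qed

lemma pending_colored: "pending c u v \<Longrightarrow> c e = Some k \<Longrightarrow> e \<in> E \<and> e \<noteq> (u, v)"
  unfolding pending_def by blast

lemma pending_child_colored: "pending c u v \<Longrightarrow> (v, w) \<in> E \<Longrightarrow> \<exists>k. c (v, w) = Some k"
  using irrefl_edge unfolding pending_def
  by (metis DiffI Pair_inject domD singletonD)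

text \<open>Besides its child edges, \<open>v\<close> has only its parent edge, which is the
  uncolored one.\<close>

lemma used_lower_endpoint:
  assumes "pending c u v"
  shows "used_colors c v = child_colors c v"
proof
  show "used_colors c v \<subseteq> child_colors c v"
  proof
    fix k assume "k \<in> used_colors c v"
    then obtain a b where e: "incident v (a, b)" "c (a, b) = Some k"
      unfolding used_colors_def by auto
    then have "(a, b) \<in> E" "(a, b) \<noteq> (u, v)" using pending_colored[OF assms] by auto
    then have "b \<noteq> v" using parent_unique assms unfolding pending_def by blast
    then show "k \<in> child_colors c v" using e unfolding incident_def child_colors_def by auto
  qed
qed (rule child_colors_subset_used)

text \<open>Counting: if both endpoints see \<open>\<Delta> - 1\<close> colors and all \<open>2 * \<Delta> - 2\<close> colors are seen,
  then the two sets of colors are complementary.\<close>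

lemma blocked:
  assumes p: "pending c u v" and b: "available \<kappa> c u \<inter> available \<kappa> c v = {}"
  shows "child_colors c v = available \<kappa> c u" and "card (child_colors c v) = \<Delta> - 1"
    and "available \<kappa> c v = {1..\<kappa>} - child_colors c v"
proof -
  have pp: "partial_proper \<kappa> c" and e: "(u, v) \<in> E" "dom c \<subseteq> E - {(u, v)}"
    using p unfolding pending_def by auto
  have cu: "card (used_colors c u) \<le> \<Delta> - 1" and cv: "card (used_colors c v) \<le> \<Delta> - 1"
    using card_used_le[OF e(2)] e(1) by (auto simp: incident_def)
  have un: "used_colors c u \<union> used_colors c v = {1..\<kappa>}"
    using b used_colors_subset[OF pp] unfolding available_eq by blast
  have fin: "finite (used_colors c u)" "finite (used_colors c v)"
    using finite_used_colors[OF pp] by auto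
  have "card (used_colors c u) + card (used_colors c v)
        = \<kappa> + card (used_colors c u \<inter> used_colors c v)"
    using card_Un_Int[OF fin] un by simp
  then have c: "card (used_colors c v) = \<Delta> - 1" "card (used_colors c u \<inter> used_colors c v) = 0"
    using cu cv Delta by auto
  then have "used_colors c u \<inter> used_colors c v = {}" using fin by simp
  then show "child_colors c v = available \<kappa> c u"
    using un unfolding available_eq used_lower_endpoint[OF p] by blast
  show "card (child_colors c v) = \<Delta> - 1" using c unfolding used_lower_endpoint[OF p] by simp
  show "available \<kappa> c v = {1..\<kappa>} - child_colors c v"
    unfolding available_eq used_lower_endpoint[OF p] by simp
qed

text \<open>If a child \<open>w\<close> is not good, it sees every color that is free at
  \<open>v\<close>, since the color of \<open>(v, w)\<close> lies in
  \<open>child_colors c v\<close>, which is \<open>A(u)\<close>. The edge \<open>(v, w)\<close>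
  carries none of these \<open>\<Delta> - 1\<close> colors but takes up one unit of the degree of
  \<open>w\<close>, so they are exactly the colors on the child edges of \<open>w\<close>.\<close>

lemma blocked_imp_tight:
  assumes p: "pending c u v" and b: "available \<kappa> c u \<inter> available \<kappa> c v = {}"
    and n: "\<nexists>w. good_child \<kappa> E c u v w"
  shows "tight \<Delta> c v"
  unfolding tight_def
proof (intro conjI allI impI)
  show "card (child_colors c v) = \<Delta> - 1" by (rule blocked(2)[OF p b])
  have pp: "partial_proper \<kappa> c" using p unfolding pending_def by auto
  fix w assume "c (v, w) \<noteq> None"
  then obtain k where k: "c (v, w) = Some k" by auto
  have w: "(v, w) \<in> E" using pending_colored[OF p k] by simp
  have kS: "k \<in> child_colors c v" using k unfolding child_colors_def by auto
  have "available \<kappa> c w \<inter> available \<kappa> c v = {}"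
    using n w k kS unfolding good_child_def blocked(1)[OF p b] by blast
  then have sub: "{1..\<kappa>} - child_colors c v \<subseteq> used_colors c w"
    using blocked(3)[OF p b] unfolding available_eq by blast
  have "used_colors c w \<subseteq> insert k (child_colors c w)"
  proof
    fix l assume "l \<in> used_colors c w"
    then obtain a d where e: "incident w (a, d)" "c (a, d) = Some l"
      unfolding used_colors_def by auto
    then have "d = w \<Longrightarrow> a = v" using parent_unique w pending_colored[OF p] by blast
    then show "l \<in> insert k (child_colors c w)"
      using e k unfolding incident_def child_colors_def by auto
  qed
  then have sub2: "{1..\<kappa>} - child_colors c v \<subseteq> child_colors c w"
    using sub kS by blast
  have "k \<notin> child_colors c w"
  proof
    assume "k \<in> child_colors c w"
    then obtain y where "c (w, y) = Some k" unfolding child_colors_def by auto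
    then have "(w, y) = (v, w)"
      using partial_proper_unique[OF pp, of w "(w, y)" "(v, w)" k] k unfolding incident_def by simp
    then show False using w irrefl_edge by simp
  qed
  moreover have "insert k (child_colors c w) \<subseteq> used_colors c w"
    using k child_colors_subset_used[of c w] unfolding used_colors_def incident_def by fastforce
  ultimately have "Suc (card (child_colors c w)) \<le> card (used_colors c w)"
    using finite_used_colors[OF pp] finite_child_colors[OF pp]
    by (metis card_insert_disjoint card_mono)
  also have "\<dots> \<le> \<Delta>" using card_used_le[of c "{}" w] p unfolding pending_def by auto
  finally have "card (child_colors c w) \<le> \<Delta> - 1" by simp
  moreover have "card ({1..\<kappa>} - child_colors c v) = \<Delta> - 1"
  proof -
    have "child_colors c v \<subseteq> {1..\<kappa>}"
      by (rule subset_trans[OF child_colors_subset_used used_colors_subset[OF pp]])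
    then show ?thesis
      using blocked(2)[OF p b] Delta finite_child_colors[OF pp] by (simp add: card_Diff_subset)
  qed
  ultimately show "child_colors c w = {1..\<kappa>} - child_colors c v"
    using sub2 finite_child_colors[OF pp] by (metis card_seteq)
qed

text \<open>By \<open>blocked\<close>, every color on a child edge of \<open>v\<close> is free at
  \<open>u\<close>; at \<open>v\<close> it becomes free once \<open>(v, w)\<close> is uncolored. So
  the shift stays proper for whichever child is chosen.\<close>

lemma pending_shift:
  assumes p: "pending c u v" and b: "available \<kappa> c u \<inter> available \<kappa> c v = {}" and w: "(v, w) \<in> E"
  shows "pending (shift c u v w) v w"
proof -
  obtain k where k: "c (v, w) = Some k" using pending_child_colored[OF p w] by auto
  have pp: "partial_proper \<kappa> c" and e: "(u, v) \<in> E" and d: "dom c = E - {(u, v)}"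
    using p unfolding pending_def by auto
  have ne: "(u, v) \<noteq> (v, w)" using e w irrefl_edge by blast
  have eq: "shift c u v w = (c((v, w) := None))((u, v) \<mapsto> k)" using k ne by (simp add: fun_upd_twist)
  have "k \<in> child_colors c v" using k unfolding child_colors_def by auto
  then have "k \<in> available \<kappa> c u" using blocked(1)[OF p b] by simp
  then have ku: "k \<in> available \<kappa> (c((v, w) := None)) u" unfolding available_def by auto
  have "(c((v, w) := None)) e \<noteq> Some k" if "incident v e" for e
    using partial_proper_unique[OF pp that, of "(v, w)" k] k unfolding incident_def by auto
  then have kv: "k \<in> available \<kappa> (c((v, w) := None)) v"
    using partial_proper_range[OF pp k] unfolding available_def by blast
  have "partial_proper \<kappa> (shift c u v w)"
    unfolding eq by (rule partial_proper_upd[OF partial_proper_uncolor[OF pp] ku kv])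
  moreover have "dom (shift c u v w) = E - {(v, w)}"
    unfolding eq using d e ne by auto
  ultimately show ?thesis using w unfolding pending_def by simp
qed

lemma card_parents_le: "finite {x. (x, u) \<in> E} \<and> card {x. (x, u) \<in> E} \<le> 1"
proof (cases "\<exists>x. (x, u) \<in> E")
  case True
  then obtain x where "(x, u) \<in> E" by auto
  then have "{x. (x, u) \<in> E} = {x}" using parent_unique by blast
  then show ?thesis by simp
qed simp

lemma finite_tight_forest: "dom c \<subseteq> E \<Longrightarrow> finite {x. tight \<Delta> c x}"
  using finite_tight[of \<Delta> c] Delta finite_edges finite_subset by fastforce

section \<open>Change of the potential in a single step\<close>

text \<open>Serves both the coloring of the last pending edge and deletions: the two vertices that
  may become tight are \<open>u\<close> and its parent.\<close>

lemma potential_change_upper: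
  assumes "dom c \<subseteq> E" "dom c' \<subseteq> E" "\<And>z y. z \<noteq> u \<Longrightarrow> c' (z, y) = c (z, y)"
  shows "potential \<Delta> c' \<le> potential \<Delta> c + 2"
proof -
  have "{x. tight \<Delta> c' x} \<subseteq> {x. tight \<Delta> c x} \<union> ({u} \<union> {x. (x, u) \<in> E})"
    using tight_local[where U = "{u}" and c = c and c' = c' and E = E] assms by blast
  then have "potential \<Delta> c' \<le> card ({x. tight \<Delta> c x} \<union> ({u} \<union> {x. (x, u) \<in> E}))"
    unfolding potential_def using finite_tight_forest[OF assms(1)] card_parents_le
    by (intro card_mono) auto
  also have "\<dots> \<le> potential \<Delta> c + (card {u} + card {x. (x, u) \<in> E})"
    unfolding potential_def by (meson add_left_mono card_Un_le order_trans)
  finally show ?thesis using card_parents_le[of u] by simp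
qed

text \<open>Child edges change at \<open>u\<close> and \<open>v\<close>, and the parent of
  \<open>v\<close> is \<open>u\<close>, which leaves three candidates for new tight vertices. This
  crude bound suffices for a shift to a good child, because the next call then stops.\<close>

lemma potential_shift_le:
  assumes p: "pending c u v" and b: "available \<kappa> c u \<inter> available \<kappa> c v = {}" and w: "(v, w) \<in> E"
  shows "potential \<Delta> (shift c u v w) \<le> potential \<Delta> c + 3"
proof -
  let ?c = "shift c u v w"
  have d: "dom c \<subseteq> E" "dom ?c \<subseteq> E"
    using p pending_shift[OF assms] unfolding pending_def by blast+
  have uv: "(u, v) \<in> E" using p unfolding pending_def by simp
  have "tight \<Delta> c y \<or> y \<in> {u, v} \<or> (\<exists>z\<in>{u, v}. (y, z) \<in> E)" if "tight \<Delta> ?c y" for y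
    using that d by (intro tight_local[where c' = ?c]) auto
  then have "{x. tight \<Delta> ?c x} \<subseteq> {x. tight \<Delta> c x} \<union> ({u, v} \<union> {x. (x, u) \<in> E})"
    using parent_unique[OF uv] by blast
  then have "potential \<Delta> ?c \<le> card ({x. tight \<Delta> c x} \<union> ({u, v} \<union> {x. (x, u) \<in> E}))"
    unfolding potential_def using finite_tight_forest[OF d(1)] card_parents_le
    by (intro card_mono) auto
  also have "\<dots> \<le> potential \<Delta> c + (card {u, v} + card {x. (x, u) \<in> E})"
    unfolding potential_def by (meson add_left_mono card_Un_le order_trans)
  also have "card {u, v} \<le> 2" by (simp add: card_insert_if)
  finally show ?thesis using card_parents_le[of u] by simp
qed

text \<open>The color \<open>\<beta>\<close> of the third rule exists and is missing on the child edges of \<open>u\<close>. Since it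
  is not chosen for \<open>(u, v)\<close> either, the parent of \<open>u\<close> does not become tight.\<close>

definition guarded :: "'v coloring \<Rightarrow> 'v \<Rightarrow> bool" where
  "guarded c u \<longleftrightarrow> (\<exists>x g k. (x, u) \<in> E \<and> (g, x) \<in> E \<and> c (g, x) = Some k \<and> k \<notin> child_colors c u)"

text \<open>For the next call, at \<open>v\<close>, the color \<beta> is that of
  \<open>(x, u)\<close>. It is used at \<open>u\<close>, hence lies outside \<open>A(u)\<close>,
  which is \<open>child_colors c v\<close>. So as soon as the upper endpoint has a parent, one shift
  establishes \<open>guarded\<close>.\<close>

lemma guarded_shift:
  assumes p: "pending c u v" and b: "available \<kappa> c u \<inter> available \<kappa> c v = {}"
    and x: "(x, u) \<in> E"
  shows "guarded (shift c u v w) v"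
proof -
  have uv: "(u, v) \<in> E" using p unfolding pending_def by simp
  have ne: "(x, u) \<noteq> (u, v)" using irrefl_edge x uv by blast
  then obtain k where k: "c (x, u) = Some k" using x p unfolding pending_def by blast
  have "k \<notin> available \<kappa> c u" using k unfolding available_def incident_def by fastforce
  then have "k \<notin> child_colors c v" using blocked(1)[OF p b] by simp
  moreover have "child_colors (shift c u v w) v \<subseteq> child_colors c v"
    using uv irrefl_edge unfolding child_colors_def by (auto split: if_splits)
  moreover have "(shift c u v w) (x, u) = Some k" 
    using k ne uv x antisym_edge irrefl_edge by auto
  ultimately show ?thesis using uv x unfolding guarded_def by blast
qed

text \<open>\<open>v\<close> was tight and loses a child color. \<open>u\<close> is not tight
  afterwards, since its child \<open>v\<close> has fewer than \<open>\<Delta> - 1\<close> child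
  colors left. Only the parent of \<open>u\<close> can become tight, and only if
  \<open>guarded c u\<close> fails; the \<open>if\<close> summand pays for that, as
  \<open>guarded\<close> then holds after the shift. The \<open>+ 1\<close> pays for the newly
  uncolored edge \<open>(v, w)\<close>.\<close>

lemma potential_shift_other:
  assumes p: "pending c u v" and b: "available \<kappa> c u \<inter> available \<kappa> c v = {}"
    and n: "\<nexists>w. good_child \<kappa> E c u v w" and w: "(v, w) \<in> E"
    and beta: "\<And>g x. (x, u) \<in> E \<Longrightarrow> (g, x) \<in> E \<Longrightarrow> c (v, w) \<noteq> c (g, x)"
  shows "potential \<Delta> (shift c u v w) + (if guarded (shift c u v w) v then 0 else 1) + 1
         \<le> potential \<Delta> c + (if guarded c u then 0 else 1)"
proof -
  let ?c = "shift c u v w"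
  have p': "pending ?c v w" by (rule pending_shift[OF p b w])
  have d: "dom c \<subseteq> E" "dom ?c \<subseteq> E" and pp: "partial_proper \<kappa> c" and pp': "partial_proper \<kappa> ?c"
    using p p' unfolding pending_def by blast+
  have uv: "(u, v) \<in> E" using p unfolding pending_def by simp
  have neq: "u \<noteq> v" "v \<noteq> w" using uv w irrefl_edge by auto
  obtain k where k: "c (v, w) = Some k" using pending_child_colored[OF p w] by auto
  have tv: "tight \<Delta> c v" by (rule blocked_imp_tight[OF p b n])
  have "child_colors ?c v \<subset> child_colors c v"
  proof
    show "child_colors ?c v \<subseteq> child_colors c v"
      using neq unfolding child_colors_def by (auto split: if_splits)
    have "k \<notin> child_colors ?c v"
    proof
      assume "k \<in> child_colors ?c v"
      then obtain y where y: "y \<noteq> w" "c (v, y) = Some k"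
        using neq unfolding child_colors_def by (auto split: if_splits)
      then show False
        using partial_proper_unique[OF pp, of v "(v, y)" "(v, w)"] k unfolding incident_def by simp
    qed
    moreover have "k \<in> child_colors c v" using k unfolding child_colors_def by auto
    ultimately show "child_colors ?c v \<noteq> child_colors c v" by blast
  qed
  then have cv: "card (child_colors ?c v) < \<Delta> - 1"
    using blocked(2)[OF p b] finite_child_colors[OF pp] by (metis psubset_card_mono)
  then have ntv: "\<not> tight \<Delta> ?c v" unfolding tight_def by simp
  have ntu: "\<not> tight \<Delta> ?c u"
  proof
    assume t: "tight \<Delta> ?c u"
    have "?c (u, v) \<noteq> None" using k neq by auto
    then have "child_colors ?c v = {1..\<kappa>} - child_colors ?c u" using t unfolding tight_def by blast
    moreover have "child_colors ?c u \<subseteq> {1..\<kappa>}"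
      by (rule subset_trans[OF child_colors_subset_used used_colors_subset[OF pp']])
    ultimately have "card (child_colors ?c v) = \<kappa> - (\<Delta> - 1)"
      using t finite_child_colors[OF pp'] unfolding tight_def by (simp add: card_Diff_subset)
    then show False using cv by simp
  qed
  have "tight \<Delta> c y \<or> y \<in> {u, v} \<or> (\<exists>z\<in>{u, v}. (y, z) \<in> E)" if "tight \<Delta> ?c y" for y
    using that d by (intro tight_local[where c' = ?c]) auto
  then have sub: "{x. tight \<Delta> ?c x} \<subseteq> ({x. tight \<Delta> c x} - {v}) \<union> {x. (x, u) \<in> E}"
    using parent_unique[OF uv] ntv ntu by blast
  have fin: "finite ({x. tight \<Delta> c x} - {v})" using finite_tight_forest[OF d(1)] by simp
  have card: "Suc (card ({x. tight \<Delta> c x} - {v})) = potential \<Delta> c"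
    unfolding potential_def using tv finite_tight_forest[OF d(1)] 
    by (metis card_Suc_Diff1 mem_Collect_eq)
  show ?thesis
  proof (cases "\<exists>x. (x, u) \<in> E \<and> tight \<Delta> ?c x")
    case False
    then have "{x. tight \<Delta> ?c x} \<subseteq> {x. tight \<Delta> c x} - {v}" using sub by blast
    then have le: "potential \<Delta> ?c + 1 \<le> potential \<Delta> c"
      using card card_mono[OF fin, of "{x. tight \<Delta> ?c x}"] unfolding potential_def by linarith
    \<comment> \<open>A guarded vertex has a parent, so \<open>guarded_shift\<close> applies
      again.\<close>
    have "guarded c u \<Longrightarrow> guarded ?c v"
      using guarded_shift[OF p b, of _ w] unfolding guarded_def[of c u] by blast
    then show ?thesis using le by simp
  next
    case True
    then obtain x where x: "(x, u) \<in> E" "tight \<Delta> ?c x" by auto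
    have "potential \<Delta> ?c \<le> card (({x. tight \<Delta> c x} - {v}) \<union> {x. (x, u) \<in> E})"
      unfolding potential_def using sub fin card_parents_le by (intro card_mono) auto
    also have "\<dots> \<le> card ({x. tight \<Delta> c x} - {v}) + card {x. (x, u) \<in> E}" by (rule card_Un_le)
    finally have le: "potential \<Delta> ?c \<le> potential \<Delta> c" using card card_parents_le[of u] by simp
    \<comment> \<open>With \<open>x\<close> tight, the color \<open>l\<close> of
      \<open>(g, x)\<close>, absent from the child edges of \<open>x\<close>, would have to occur on
      those of \<open>u\<close>. It did not before, and by \<open>beta\<close> the new color of
      \<open>(u, v)\<close> differs from it.\<close>
    have "\<not> guarded c u"
    proof
      assume "guarded c u"
      then obtain g l where g: "(g, x) \<in> E" "c (g, x) = Some l" "l \<notin> child_colors c u"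
        using x(1) parent_unique unfolding guarded_def by blast
      have xu: "x \<noteq> u" "x \<noteq> v" "g \<noteq> x" "x \<noteq> w"
        using x(1) g(1) uv w irrefl_edge antisym_edge no_triangle by blast+
      have "?c (x, u) \<noteq> None" 
        using x(1) p xu unfolding pending_def by auto
      then have "child_colors ?c u = {1..\<kappa>} - child_colors ?c x"
        using x(2) unfolding tight_def by blast
      moreover have "l \<in> {1..\<kappa>}" using partial_proper_range[OF pp g(2)] .
      moreover have "l \<notin> child_colors ?c x"
      proof
        assume "l \<in> child_colors ?c x"
        then obtain y where "c (x, y) = Some l"
          using xu unfolding child_colors_def by (auto split: if_splits)
        then show False
          using partial_proper_unique[OF pp, of x "(x, y)" "(g, x)" l] g xu unfolding incident_def
          by simp
      qed
      ultimately have "l \<in> child_colors ?c u" by blast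
      then have "l \<in> child_colors c u \<or> Some l = c (v, w)"
        using neq unfolding child_colors_def by (auto split: if_splits)
      then show False using g beta[OF x(1) g(1)] by simp
    qed
    then show ?thesis using le guarded_shift[OF p b x(1)] by simp
  qed
qed

section \<open>The invariant of an insertion\<close>

text \<open>The first alternative is the regular phase, with one unit of credit for a shift that is
  not guarded. The second holds after a shift to a good child, when the endpoints share a color and
  only coloring can follow. The constants are \<open>5 = 1 + 1 + 3\<close> (one more changed edge,
  at most three new tight vertices) and \<open>7 = 5 + 2\<close> (the final coloring).\<close>

fun step_inv :: "'v coloring \<Rightarrow> 'v config \<Rightarrow> bool" where
  "step_inv c0 (Step c u v) \<longleftrightarrow> pending c u v \<and>
     (card (changed c0 c) + potential \<Delta> c + (if guarded c u then 0 else 1) \<le> potential \<Delta> c0 + 1 \<or>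
      available \<kappa> c u \<inter> available \<kappa> c v \<noteq> {} \<and>
      card (changed c0 c) + potential \<Delta> c \<le> potential \<Delta> c0 + 5)"
| "step_inv c0 (Stop c) \<longleftrightarrow> proper_edge_coloring \<kappa> E c \<and>
     card (changed c0 c) + potential \<Delta> c \<le> potential \<Delta> c0 + 7"

lemma step_inv_step:
  assumes "cp_step \<kappa> E s s'" "finite (dom c0)" "step_inv c0 s"
  shows "step_inv c0 s'"
  using assms(1)
proof cases
  case (common_color k c u v)
  have p: "pending c u v" using assms(3) common_color by simp
  then have N: "c (u, v) = None" unfolding pending_def by blast
  have pp: "partial_proper \<kappa> (c((u, v) \<mapsto> k))"
    using p common_color by (auto intro!: partial_proper_upd simp: pending_def)
  have d: "dom (c((u, v) \<mapsto> k)) = E" using p unfolding pending_def by auto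
  have "proper_edge_coloring \<kappa> E (c((u, v) \<mapsto> k))"
    using pp d unfolding proper_edge_coloring_iff by blast
  moreover have "potential \<Delta> (c((u, v) \<mapsto> k)) \<le> potential \<Delta> c + 2"
    using p d unfolding pending_def by (intro potential_change_upper[where u = u]) auto
  ultimately show ?thesis
    using assms(3) card_changed_color[where c = c and k = k, OF assms(2) N] common_color
    by (auto split: if_splits)
next
  case (shift_good c u v w)
  have p: "pending c u v" using assms(3) shift_good by simp
  then have N: "c (u, v) = None" unfolding pending_def by blast
  have w: "(v, w) \<in> E" and wv: "available \<kappa> c w \<inter> available \<kappa> c v \<noteq> {}"
    using shift_good unfolding good_child_def by auto
  have uv: "(u, v) \<in> E" using p unfolding pending_def by simp
  have neq: "u \<noteq> v" "v \<noteq> w" "u \<noteq> w" using uv w irrefl_edge antisym_edge by auto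
  \<comment> \<open>At \<open>v\<close> the shifted color only moves to another incident edge, and
    at \<open>w\<close> it disappears, so the common free color of \<open>v\<close> and
    \<open>w\<close> stays free.\<close>
  have "used_colors (shift c u v w) v \<subseteq> used_colors c v"
    unfolding used_colors_def by (auto simp: incident_def split: if_splits)
  moreover have "used_colors (shift c u v w) w \<subseteq> used_colors c w"
    using neq unfolding used_colors_def by (auto simp: incident_def split: if_splits)
  ultimately have "available \<kappa> (shift c u v w) v \<inter> available \<kappa> (shift c u v w) w \<noteq> {}"
    using wv unfolding available_eq by blast
  then show ?thesis
    using assms(3) shift_good pending_shift[OF p shift_good(3) w]
      potential_shift_le[OF p shift_good(3) w] card_changed_shift[where c = c and w = w, OF assms(2) N]
    by (auto split: if_splits)
next
  case (shift_other c u v w)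
  have p: "pending c u v" using assms(3) shift_other by simp
  then have N: "c (u, v) = None" unfolding pending_def by blast
  show ?thesis
    using assms(3) shift_other pending_shift[OF p shift_other(3,5)]
      potential_shift_other[OF p shift_other(3,4,5,6)]
      card_changed_shift[where c = c and w = w, OF assms(2) N]
    by auto
qed

lemma step_inv_reachable:
  assumes "(cp_step \<kappa> E)\<^sup>*\<^sup>* s s'" "finite (dom c0)" "step_inv c0 s"
  shows "step_inv c0 s'"
  using assms(1,3) by induction (use step_inv_step[OF _ assms(2)] in auto)

lemma step_inv_start:
  assumes "(p, r) \<in> E" "proper_edge_coloring \<kappa> (E - {(p, r)}) c"
  shows "step_inv c (Step (c((p, r) := None)) p r)"
proof -
  have d: "dom c = E - {(p, r)}" using assms(2) unfolding proper_edge_coloring_iff by simp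
  then have "c((p, r) := None) = c" by (auto simp: fun_upd_idem_iff dom_def)
  moreover have "changed c c = {}" unfolding changed_def by simp
  ultimately show ?thesis
    using assms d by (simp add: pending_def proper_edge_coloring_iff)
qed

section \<open>Progress and termination\<close>

text \<open>In a blocked call \<open>v\<close> has \<open>\<Delta> - 1 \<ge> 2\<close> child colors,
  so some child edge avoids \<beta> and the third rule applies unless the second does.\<close>

lemma progress:
  assumes p: "pending c u v"
  shows "\<exists>s. cp_step \<kappa> E (Step c u v) s"
proof (cases "available \<kappa> c u \<inter> available \<kappa> c v = {}")
  case False
  then obtain k where "k \<in> available \<kappa> c u \<inter> available \<kappa> c v" by blast
  then show ?thesis using cp_step.common_color[where k = k and c = c and u = u and v = v] by blast
next
  case b: True
  show ?thesis
  proof (cases "\<exists>w. good_child \<kappa> E c u v w")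
    case True
    then show ?thesis using cp_step.shift_good[OF b] by blast
  next
    case n: False
    have pp: "partial_proper \<kappa> c" using p unfolding pending_def by simp
    \<comment> \<open>\<open>b\<close> is \<beta> as an option, arbitrary if there is no grandparent
      edge. Should it be \<open>None\<close>, then \<open>the b\<close> is an unspecified number,
      and avoiding it does no harm.\<close>
    obtain b where b': "\<And>g x. (x, u) \<in> E \<Longrightarrow> (g, x) \<in> E \<Longrightarrow> c (g, x) = b"
      using parent_unique by metis
    have "\<not> child_colors c v \<subseteq> {the b}"
    proof
      assume "child_colors c v \<subseteq> {the b}"
      then have "card (child_colors c v) \<le> 1" by (metis card.empty card_mono finite.simps is_singletonI is_singleton_altdef)
      then show False using blocked(2)[OF p b] Delta by simp
    qed
    then obtain k w where k: "c (v, w) = Some k" "k \<noteq> the b"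
      unfolding child_colors_def by auto
    then have "(v, w) \<in> E" using pending_colored[OF p] by blast
    moreover have "c (v, w) \<noteq> b" using k by auto
    ultimately show ?thesis using cp_step.shift_other[OF b n, of w] b' by metis
  qed
qed

text \<open>Each shift moves the pending edge one level down, so well-founded induction along the
  converse of the finite acyclic \<open>E\<close> works for every coloring.\<close>

lemma termip_Step: "termip (cp_step \<kappa> E) (Step c u v)"
proof -
  have stop: "termip (cp_step \<kappa> E) (Stop c')" for c'
    by (rule accpI) (auto elim: cp_step.cases)
  have "wf (E\<inverse>)" using finite_acyclic_wf_converse finite_edges acyclic_edges by blast
  then show ?thesis
  proof (induction v arbitrary: c u rule: wf_induct_rule)
    case (less v)
    have IH: "termip (cp_step \<kappa> E) (Step c' v w)" if "(v, w) \<in> E" for c' w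
      using less that by blast
    show ?case
    proof (rule accpI)
      fix s assume "(cp_step \<kappa> E)\<inverse>\<inverse> s (Step c u v)"
      then have "cp_step \<kappa> E (Step c u v) s" by simp
      then show "termip (cp_step \<kappa> E) s"
      proof cases
        case common_color
        then show ?thesis using stop by simp
      next
        case (shift_good w)
        then show ?thesis using IH unfolding good_child_def by blast
      next
        case (shift_other w)
        then show ?thesis using IH by blast
      qed
    qed
  qed
qed

lemma cp_update_insert:
  assumes "(p, r) \<in> E" "proper_edge_coloring \<kappa> (E - {(p, r)}) c"
    and "(cp_step \<kappa> E)\<^sup>*\<^sup>* (Step (c((p, r) := None)) p r) (Stop c')"
  shows "proper_edge_coloring \<kappa> E c' \<and> recourse c c' + potential \<Delta> c' \<le> potential \<Delta> c + 7"
proof -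
  have fin: "finite (dom c)"
    using assms(2) finite_edges unfolding proper_edge_coloring_iff by simp
  have "step_inv c (Stop c')"
    by (rule step_inv_reachable[OF assms(3) fin step_inv_start[OF assms(1,2)]])
  moreover have "recourse c c' \<le> card (changed c c')"
    unfolding recourse_def changed_def using fin by (intro card_mono) auto
  ultimately show ?thesis by auto
qed

lemma cp_insert_terminates:
  assumes "(p, r) \<in> E" "proper_edge_coloring \<kappa> (E - {(p, r)}) c"
    and "(cp_step \<kappa> E)\<^sup>*\<^sup>* (Step (c((p, r) := None)) p r) s'" "\<nexists>s''. cp_step \<kappa> E s' s''"
  shows "\<exists>c'. s' = Stop c'"
proof (cases s')
  case (Step c' u v)
  have "finite (dom c)"
    using assms(2) finite_edges unfolding proper_edge_coloring_iff by simp
  then have "step_inv c s'"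
    using step_inv_reachable[OF assms(3) _ step_inv_start[OF assms(1,2)]] by simp
  then show ?thesis using progress assms(4) Step by auto
qed simp

text \<open>Nothing is recolored, but the lost child color may make \<open>u\<close> or its parent
  tight. The bound is stated with 7 to match insertions.\<close>

lemma cp_update_delete:
  assumes "proper_edge_coloring \<kappa> E c"
  shows "proper_edge_coloring \<kappa> (E - {(u, v)}) (c((u, v) := None)) \<and>
    recourse c (c((u, v) := None)) + potential \<Delta> (c((u, v) := None)) \<le> potential \<Delta> c + 7"
proof -
  have d: "dom c = E" "partial_proper \<kappa> c" using assms unfolding proper_edge_coloring_iff by auto
  have "potential \<Delta> (c((u, v) := None)) \<le> potential \<Delta> c + 2"
    using d by (intro potential_change_upper[where u = u]) auto
  moreover have "{e \<in> dom c \<inter> dom (c((u, v) := None)). c e \<noteq> (c((u, v) := None)) e} = {}"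
    by auto
  then have "recourse c (c((u, v) := None)) = 0" unfolding recourse_def by (metis card.empty)
  ultimately show ?thesis
    using d partial_proper_uncolor unfolding proper_edge_coloring_iff by auto
qed

end


section \<open>Update sequences\<close>

lemma forest_of_Nil [simp]: "forest_of [] = {}"
  by (simp add: forest_of_def)

lemma forest_of_snoc [simp]: "forest_of (\<sigma> @ [u]) = apply_update (forest_of \<sigma>) u"
  by (simp add: forest_of_def)

lemma legal_sequence_Nil [simp]: "legal_sequence \<Delta> V []"
  by (simp add: legal_sequence_def)

lemma legal_sequence_snoc:
  "legal_sequence \<Delta> V (\<sigma> @ [u]) \<longleftrightarrow> legal_sequence \<Delta> V \<sigma> \<and> admissible V (forest_of \<sigma>) u \<and>
     (\<forall>x\<in>V. degree (forest_of (\<sigma> @ [u])) x \<le> \<Delta>)"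
proof -
  have "take i (\<sigma> @ [u]) = take i \<sigma>" "(\<sigma> @ [u]) ! i = \<sigma> ! i"
    "take (Suc i) (\<sigma> @ [u]) = take (Suc i) \<sigma>" if "i < length \<sigma>" for i
    using that by (auto simp: nth_append)
  then show ?thesis unfolding legal_sequence_def by (auto simp: All_less_Suc)
qed

lemma legal_sequence_take:
  assumes "legal_sequence \<Delta> V \<sigma>"
  shows "legal_sequence \<Delta> V (take i \<sigma>)"
  using assms unfolding legal_sequence_def by (auto simp: min_def)

lemma legal_sequence_nth:
  assumes "legal_sequence \<Delta> V \<sigma>" "i < length \<sigma>"
  shows "admissible V (forest_of (take i \<sigma>)) (\<sigma> ! i)"
    and "forest_of (take (Suc i) \<sigma>) = apply_update (forest_of (take i \<sigma>)) (\<sigma> ! i)"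
  using assms by (auto simp: legal_sequence_def take_Suc_conv_app_nth)

lemma legal_sequence_forest:
  assumes "legal_sequence \<Delta> V \<sigma>"
  shows "finite (forest_of \<sigma>) \<and> forest_of \<sigma> \<subseteq> V \<times> V \<and> acyclic (forest_of \<sigma>) \<and>
    (\<forall>x y v. (x, v) \<in> forest_of \<sigma> \<longrightarrow> (y, v) \<in> forest_of \<sigma> \<longrightarrow> x = y)"
  using assms
proof (induction \<sigma> rule: rev_induct)
  case Nil
  then show ?case by (simp add: acyclic_def)
next
  case (snoc u \<sigma>)
  let ?E = "forest_of \<sigma>"
  have IH: "finite ?E" "?E \<subseteq> V \<times> V" "acyclic ?E"
    "\<And>x y v. (x, v) \<in> ?E \<Longrightarrow> (y, v) \<in> ?E \<Longrightarrow> x = y"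
    and adm: "admissible V ?E u"
    using snoc unfolding legal_sequence_snoc by blast+
  show ?case
  proof (cases u)
    case (Insert p r)
    then have a: "p \<in> V" "r \<in> V" "\<And>q. (q, r) \<notin> ?E" "\<not> same_tree ?E p r"
      using adm by (auto simp: is_root_def)
    \<comment> \<open>A directed path from \<open>r\<close> to \<open>p\<close> would place both in
      one tree, so the new edge closes no cycle.\<close>
    have "(r, p) \<notin> ?E\<^sup>*"
    proof
      assume "(r, p) \<in> ?E\<^sup>*"
      then have "(p, r) \<in> (?E\<inverse>)\<^sup>*" by (simp add: rtrancl_converse)
      then show False using a(4) rtrancl_mono[of "?E\<inverse>" "?E \<union> ?E\<inverse>"] unfolding same_tree_def by blast
    qed
    then show ?thesis using IH a Insert by (auto simp: acyclic_insert)
  next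
    case (Delete a b)
    then show ?thesis using IH by (auto intro: acyclic_subset)
  qed
qed

text \<open>\<open>legal_sequence\<close> bounds degrees only after an update and only on
  \<open>V\<close>; in the empty forest and outside \<open>V\<close> all degrees are 0.\<close>

lemma legal_sequence_degree:
  assumes "legal_sequence \<Delta> V \<sigma>"
  shows "degree (forest_of \<sigma>) x \<le> \<Delta>"
proof (cases "\<sigma> = [] \<or> x \<notin> V")
  case True
  then have "{e \<in> forest_of \<sigma>. incident x e} = {}"
    using legal_sequence_forest[OF assms] unfolding incident_def by auto
  then show ?thesis unfolding degree_def by (metis card.empty zero_le)
next
  case False
  then obtain \<tau> u where "\<sigma> = \<tau> @ [u]" by (metis rev_exhaust)
  then show ?thesis using assms False legal_sequence_snoc by metis
qed

lemma legal_bounded_forest: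
  assumes "\<Delta> \<ge> 3" "legal_sequence \<Delta> V \<sigma>"
  shows "bounded_forest \<Delta> (forest_of \<sigma>)"
  using legal_sequence_forest[OF assms(2)] legal_sequence_degree[OF assms(2)] assms(1)
  by unfold_locales blast+


section \<open>The upper bound\<close>

lemma cp_update_invariant:
  assumes D: "\<Delta> \<ge> 3" and legal: "legal_sequence \<Delta> V \<sigma>" and i: "i < length \<sigma>"
    and c: "proper_edge_coloring (2 * \<Delta> - 2) (forest_of (take i \<sigma>)) c"
  shows "cp_update (2 * \<Delta> - 2) (forest_of (take i \<sigma>)) (\<sigma> ! i) c c' \<Longrightarrow>
      proper_edge_coloring (2 * \<Delta> - 2) (forest_of (take (Suc i) \<sigma>)) c' \<and>
      recourse c c' + potential \<Delta> c' \<le> potential \<Delta> c + 7"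
    and "cp_terminates (2 * \<Delta> - 2) (forest_of (take i \<sigma>)) (\<sigma> ! i) c"
proof -
  let ?E = "forest_of (take i \<sigma>)" and ?E' = "forest_of (take (Suc i) \<sigma>)"
  \<comment> \<open>Insertions are analyzed in the forest after the update, deletions in the one
    before.\<close>
  interpret E: bounded_forest \<Delta> ?E
    by (rule legal_bounded_forest[OF D legal_sequence_take[OF legal]])
  interpret E': bounded_forest \<Delta> ?E'
    by (rule legal_bounded_forest[OF D legal_sequence_take[OF legal]])
  note n = legal_sequence_nth[OF legal i]
  have ins: "(p, r) \<in> ?E'" "proper_edge_coloring (2 * \<Delta> - 2) (?E' - {(p, r)}) c"
    "?E' = insert (p, r) ?E" if "\<sigma> ! i = Insert p r" for p r
    using that n c by (auto simp: is_root_def)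
  show "proper_edge_coloring (2 * \<Delta> - 2) ?E' c' \<and>
      recourse c c' + potential \<Delta> c' \<le> potential \<Delta> c + 7"
    if "cp_update (2 * \<Delta> - 2) ?E (\<sigma> ! i) c c'"
  proof (cases "\<sigma> ! i")
    case (Insert p r)
    then show ?thesis using that E'.cp_update_insert[OF ins(1,2)] ins(3) by simp
  next
    case (Delete u v)
    then show ?thesis using that E.cp_update_delete[OF c] n(2) by simp
  qed
  show "cp_terminates (2 * \<Delta> - 2) ?E (\<sigma> ! i) c"
  proof (cases "\<sigma> ! i")
    case (Insert p r)
    then show ?thesis
      using E'.termip_Step E'.cp_insert_terminates[OF ins(1,2)] ins(3) by (simp add: Let_def)
  qed simp
qed

text \<open>The amortized bounds telescope. The empty coloring has potential 0, since a tight vertex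
  needs a child color.\<close>

lemma cp_run_invariant:
  assumes "\<Delta> \<ge> 3" "legal_sequence \<Delta> V \<sigma>" "cp_run (2 * \<Delta> - 2) \<sigma> \<gamma>" "i \<le> length \<sigma>"
  shows "proper_edge_coloring (2 * \<Delta> - 2) (forest_of (take i \<sigma>)) (\<gamma> i) \<and>
    (\<Sum>j<i. recourse (\<gamma> j) (\<gamma> (Suc j))) + potential \<Delta> (\<gamma> i) \<le> 7 * i"
  using assms(4)
proof (induction i)
  case 0
  have "\<gamma> 0 = Map.empty" using assms(3) by (simp add: cp_run_def)
  then show ?case
    using assms(1) partial_proper_empty
    by (simp add: proper_edge_coloring_iff potential_def tight_def child_colors_def)
next
  case (Suc i)
  then have i: "i < length \<sigma>" by simp
  then have u: "cp_update (2 * \<Delta> - 2) (forest_of (take i \<sigma>)) (\<sigma> ! i) (\<gamma> i) (\<gamma> (Suc i))"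
    using assms(3) by (simp add: cp_run_def)
  show ?case using cp_update_invariant(1)[OF assms(1,2) i _ u] Suc by simp
qed

lemma cp_maintains_proper_legal:
  assumes "\<Delta> \<ge> 3" "legal_sequence \<Delta> V \<sigma>"
  shows "cp_maintains_proper (2 * \<Delta> - 2) \<sigma>"
  unfolding cp_maintains_proper_def
proof (intro allI impI)
  fix \<gamma> i assume i: "i \<le> length \<sigma>" and run: "cp_run (2 * \<Delta> - 2) (take i \<sigma>) \<gamma>"
  have "proper_edge_coloring (2 * \<Delta> - 2) (forest_of (take i \<sigma>)) (\<gamma> i)"
    using cp_run_invariant[OF assms(1) legal_sequence_take[OF assms(2)] run, of i] i by simp
  then show "proper_edge_coloring (2 * \<Delta> - 2) (forest_of (take i \<sigma>)) (\<gamma> i) \<and>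
      (i < length \<sigma> \<longrightarrow> cp_terminates (2 * \<Delta> - 2) (forest_of (take i \<sigma>)) (\<sigma> ! i) (\<gamma> i))"
    using cp_update_invariant(2)[OF assms] by blast
qed

lemma amortized_recourse_cp_run:
  assumes "\<Delta> \<ge> 3" "legal_sequence \<Delta> V \<sigma>" "cp_run (2 * \<Delta> - 2) \<sigma> \<gamma>"
  shows "amortized_recourse (length \<sigma>) \<gamma> \<le> 7"
proof -
  have "(\<Sum>j<length \<sigma>. recourse (\<gamma> j) (\<gamma> (Suc j))) \<le> 7 * length \<sigma>"
    using cp_run_invariant[OF assms, of "length \<sigma>"] by simp
  then have "real (\<Sum>j<length \<sigma>. recourse (\<gamma> j) (\<gamma> (Suc j))) \<le> 7 * real (length \<sigma>)"
    by (metis of_nat_le_iff of_nat_mult of_nat_numeral)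
  then show ?thesis
    \<comment> \<open>For the empty sequence the quotient is \<open>0 / 0 = 0\<close>.\<close>
    unfolding amortized_recourse_def by (cases "length \<sigma> = 0") (simp_all add: divide_le_eq)
qed


section \<open>The lower bound\<close>

text \<open>A set \<open>S\<close> that no edge enters or leaves is a union of trees. Such sets
  certify the legality of the insertions of the adversary.\<close>

lemma not_same_tree:
  assumes "\<And>a b. (a, b) \<in> E \<Longrightarrow> a \<in> S \<longleftrightarrow> b \<in> S" "x \<in> S" "y \<notin> S"
  shows "\<not> same_tree E x y"
proof
  assume "same_tree E x y"
  then have "(x, y) \<in> (E \<union> E\<inverse>)\<^sup>*" by (simp add: same_tree_def)
  then have "y \<in> S" using assms(1,2) by (induction) auto
  then show False using assms(3) by simp
qed

lemma degree_mono: "finite F \<Longrightarrow> E \<subseteq> F \<Longrightarrow> degree E x \<le> degree F x"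
  unfolding degree_def by (rule card_mono) auto

definition total_recourse :: "'v det_algorithm \<Rightarrow> 'v update list \<Rightarrow> nat" where
  "total_recourse alg \<sigma> = (\<Sum>i<length \<sigma>. recourse (alg (take i \<sigma>)) (alg (take (Suc i) \<sigma>)))"

lemma total_recourse_snoc:
  "total_recourse alg (\<sigma> @ [u]) = total_recourse alg \<sigma> + recourse (alg \<sigma>) (alg (\<sigma> @ [u]))"
  by (simp add: total_recourse_def)

text \<open>The centers of the stars are \<open>0, \<dots>, M - 1\<close>, the vertex \<open>l\<close> with \<open>M \<le> l < M * \<Delta>\<close> is a leaf
  of the star with center \<open>l mod M\<close>, and \<open>M * \<Delta>\<close> is the hub, to which the adversary attaches
  stars. The number of stars is chosen such that always some \<open>3 * \<Delta>\<close> of them use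
  the same set of colors.\<close>

locale star_adversary =
  fixes \<Delta> n :: nat and alg :: "nat det_algorithm"
  assumes Delta: "\<Delta> \<ge> 3"
    and vertices: "n > 3 * \<Delta> * 2 ^ (2 * \<Delta> - 2) * \<Delta>"
    and alg: "maintains_proper (2 * \<Delta> - 2) \<Delta> {..<n} alg"
begin

abbreviation "\<kappa> \<equiv> 2 * \<Delta> - 2"

definition M :: nat where "M = 3 * \<Delta> * 2 ^ \<kappa>"

definition hub :: nat where "hub = M * \<Delta>"

definition star_edges :: "nat edge set" where
  "star_edges = {(r, l). M \<le> l \<and> l < hub \<and> r = l mod M}"

definition attached :: "nat set \<Rightarrow> nat edge set" where
  "attached T = star_edges \<union> {hub} \<times> T"

lemma M_pos: "M > 0" and M_le_hub: "M \<le> hub" and hub_less: "hub < n"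
  using Delta vertices unfolding M_def hub_def by auto

lemma star_edgesD: "(r, l) \<in> star_edges \<Longrightarrow> r < M \<and> M \<le> l \<and> l < hub \<and> r = l mod M"
  unfolding star_edges_def using M_pos by auto

lemma finite_star_edges: "finite star_edges"
  by (rule finite_subset[of _ "{..<M} \<times> {..<hub}"]) (use star_edgesD in auto)

lemma finite_attached: "T \<subseteq> {..<M} \<Longrightarrow> finite (attached T)"
  unfolding attached_def using finite_star_edges finite_subset by auto

text \<open>The numbers from \<open>M\<close> to below \<open>M * \<Delta>\<close> with residue
  \<open>r\<close> are \<open>r + M * i\<close> for \<open>1 \<le> i < \<Delta>\<close>. One unit of
  the degree of the center remains for a hub edge.\<close>

lemma card_leaves:
  assumes "r < M"
  shows "card {l. (r, l) \<in> star_edges} = \<Delta> - 1"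
proof -
  have "{l. (r, l) \<in> star_edges} = (\<lambda>i. r + M * i) ` {1..<\<Delta>}"
  proof (intro set_eqI iffI)
    fix l assume "l \<in> {l. (r, l) \<in> star_edges}"
    then have l: "M \<le> l" "l < M * \<Delta>" "r = l mod M"
      unfolding star_edges_def hub_def by auto
    have "l = r + M * (l div M)" using l(3) by simp
    moreover have "l div M < \<Delta>" using l(2) by (simp add: less_mult_imp_div_less mult.commute)
    moreover have "1 \<le> l div M" using l(1) M_pos by (simp add: Suc_le_eq div_greater_zero_iff)
    ultimately show "l \<in> (\<lambda>i. r + M * i) ` {1..<\<Delta>}" by auto
  next
    fix l assume "l \<in> (\<lambda>i. r + M * i) ` {1..<\<Delta>}"
    then obtain i where i: "1 \<le> i" "i < \<Delta>" "l = r + M * i" by auto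
    have "M * 1 \<le> M * i" using i(1) by (rule mult_le_mono2)
    then have "M \<le> l" using i(3) by linarith
    moreover have "M * Suc i \<le> M * \<Delta>" using i(2) by (intro mult_le_mono2) simp
    then have "l < M * \<Delta>" using i(3) assms by simp
    moreover have "l mod M = r" using i(3) assms by simp
    ultimately show "l \<in> {l. (r, l) \<in> star_edges}"
      unfolding star_edges_def hub_def by simp
  qed
  moreover have "inj_on (\<lambda>i. r + M * i) {1..<\<Delta>}" using M_pos by (auto simp: inj_on_def)
  ultimately show ?thesis by (simp add: card_image)
qed

lemma degree_attached:
  assumes T: "T \<subseteq> {..<M}" and cT: "card T \<le> \<Delta>"
  shows "degree (attached T) x \<le> \<Delta>"
proof -
  let ?I = "{e \<in> attached T. incident x e}"
  have finT: "finite T" by (rule finite_subset[OF T]) simp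
  consider "x < M" | "M \<le> x" "x < hub" | "x = hub" | "x > hub" by linarith
  then show ?thesis
  proof cases
    case 1
    have fin: "finite {l. (x, l) \<in> star_edges}" 
      using card_leaves[OF 1] Delta card.infinite by fastforce
    have "?I \<subseteq> insert (hub, x) (Pair x ` {l. (x, l) \<in> star_edges})"
      using 1 star_edgesD M_le_hub unfolding attached_def incident_def by fastforce
    then have "card ?I \<le> card (insert (hub, x) (Pair x ` {l. (x, l) \<in> star_edges}))"
      using fin by (intro card_mono) auto
    also have "\<dots> \<le> Suc (card (Pair x ` {l. (x, l) \<in> star_edges}))"
      using fin by (simp add: card_insert_if)
    also have "\<dots> \<le> Suc (\<Delta> - 1)"
      using card_image_le[OF fin, of "Pair x"] card_leaves[OF 1] by simp
    finally show ?thesis using Delta unfolding degree_def by simp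
  next
    case 2
    have "?I \<subseteq> {(x mod M, x)}"
      using 2 star_edgesD T unfolding attached_def incident_def by fastforce
    then have "card ?I \<le> card {(x mod M, x)}" by (intro card_mono) auto
    then show ?thesis using Delta unfolding degree_def by simp
  next
    case 3
    have "?I \<subseteq> Pair hub ` T"
      using 3 star_edgesD T M_le_hub unfolding attached_def incident_def by fastforce
    then have "card ?I \<le> card (Pair hub ` T)" using finT by (intro card_mono) auto
    also have "\<dots> \<le> card T" by (rule card_image_le[OF finT])
    finally show ?thesis using cT unfolding degree_def by simp
  next
    case 4
    have "?I = {}"
      using 4 star_edgesD T M_le_hub unfolding attached_def incident_def by fastforce
    then show ?thesis unfolding degree_def by (metis card.empty zero_le)
  qed
qed

section \<open>Building the stars\<close>

definition build :: "nat \<Rightarrow> nat update list" where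
  "build m = map (\<lambda>l. Insert (l mod M) l) [M..<m]"

lemma build_stars:
  assumes "M \<le> m" "m \<le> hub"
  shows "legal_sequence \<Delta> {..<n} (build m) \<and> forest_of (build m) = {(r, l) \<in> star_edges. l < m}"
  using assms
proof (induction m rule: dec_induct)
  case base
  show ?case by (auto simp: build_def dest!: star_edgesD)
next
  case (step m)
  let ?E = "forest_of (build m)"
  have IH: "legal_sequence \<Delta> {..<n} (build m)" "?E = {(r, l) \<in> star_edges. l < m}"
    using step by auto
  have m: "M \<le> m" "m < hub" using step.hyps step.prems by simp_all
  have snoc: "build (Suc m) = build m @ [Insert (m mod M) m]"
    using m by (simp add: build_def)
  have E': "insert (m mod M, m) ?E = {(r, l) \<in> star_edges. l < Suc m}"
    unfolding IH(2) using m by (auto simp: star_edges_def less_Suc_eq)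
  have mM: "m mod M < M" using M_pos by simp
  \<comment> \<open>The vertex \<open>m\<close> is still isolated, so no edge crosses the boundary
    of its complement.\<close>
  have "\<not> same_tree ?E (m mod M) m"
    by (rule not_same_tree[where S = "- {m}"]) (use IH(2) star_edgesD m mM in fastforce)+
  moreover have "is_root ?E m" using IH(2) by (auto simp: is_root_def)
  ultimately have "admissible {..<n} ?E (Insert (m mod M) m)"
    using m mM hub_less by simp
  moreover have "degree (insert (m mod M, m) ?E) x \<le> \<Delta>" for x
  proof -
    have "degree (insert (m mod M, m) ?E) x \<le> degree (attached {}) x"
      unfolding E' by (rule degree_mono[OF finite_attached]) (auto simp: attached_def)
    then show ?thesis using degree_attached[of "{}" x] by simp
  qed
  ultimately show ?case using IH(1) E' by (simp add: snoc legal_sequence_snoc)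
qed

lemma build_hub: "legal_sequence \<Delta> {..<n} (build hub)" "forest_of (build hub) = attached {}"
  using build_stars[OF M_le_hub] star_edgesD by (auto simp: attached_def)

section \<open>Color sets of the stars\<close>

definition colored_stars :: "nat coloring \<Rightarrow> nat set \<Rightarrow> nat set" where
  "colored_stars c X = {r \<in> {..<M}. child_colors c r = X}"

text \<open>The adversary aims at attaching stars that all use the color set \<open>X\<close>. Each of its updates
  increases this quantity by one, and each recolored edge decreases it by at most three.\<close>

definition advantage :: "nat coloring \<Rightarrow> nat set \<Rightarrow> nat set \<Rightarrow> int" where
  "advantage c X T = 2 * int (card (T \<inter> colored_stars c X)) - int (card T)
     + int (min (card (colored_stars c X)) (3 * \<Delta>))"

lemma finite_colored_stars: "finite (colored_stars c X)"
  by (simp add: colored_stars_def)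

context
  fixes c :: "nat coloring" and T :: "nat set"
  assumes T: "T \<subseteq> {..<M}" and c: "proper_edge_coloring \<kappa> (attached T) c"
begin

lemma dom_c: "dom c = attached T" and proper_c: "partial_proper \<kappa> c"
  using c unfolding proper_edge_coloring_iff by auto

lemma child_colors_star:
  assumes "r < M"
  shows "child_colors c r = (\<lambda>l. the (c (r, l))) ` {l. (r, l) \<in> star_edges}"
proof -
  have e: "(r, l) \<in> attached T \<longleftrightarrow> (r, l) \<in> star_edges" for l
    using assms M_le_hub unfolding attached_def by auto
  have "(\<exists>k. c (r, l) = Some k) \<longleftrightarrow> (r, l) \<in> star_edges" for l
    using e dom_c by blast
  then show ?thesis unfolding child_colors_def by (force simp: image_iff)
qed

lemma card_child_colors_star:
  assumes "r < M"
  shows "card (child_colors c r) = \<Delta> - 1"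
proof -
  have "inj_on (\<lambda>l. the (c (r, l))) {l. (r, l) \<in> star_edges}"
  proof (rule inj_onI)
    fix l l' assume l: "l \<in> {l. (r, l) \<in> star_edges}" "l' \<in> {l. (r, l) \<in> star_edges}"
      and eq: "the (c (r, l)) = the (c (r, l'))"
    obtain k where "c (r, l) = Some k" "c (r, l') = Some k"
      using l eq dom_c unfolding attached_def by (metis UnI1 domD mem_Collect_eq option.sel)
    then show "l = l'"
      using partial_proper_unique[OF proper_c, of r "(r, l)" "(r, l')"] by (simp add: incident_def)
  qed
  then show ?thesis
    unfolding child_colors_star[OF assms] using card_leaves[OF assms] by (simp add: card_image)
qed

lemma child_colors_star_subset: "child_colors c r \<subseteq> {1..\<kappa>}"
  by (rule subset_trans[OF child_colors_subset_used used_colors_subset[OF proper_c]])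

text \<open>Pigeonhole: \<open>M = 3 * \<Delta> * 2 ^ \<kappa>\<close> stars share at most
  \<open>2 ^ \<kappa>\<close> color sets.\<close>

lemma popular_color_set: "\<exists>X. card (colored_stars c X) \<ge> 3 * \<Delta>"
proof (rule ccontr)
  assume "\<not> ?thesis"
  then have small: "card (colored_stars c X) \<le> 3 * \<Delta> - 1" for X
    by (metis Suc_leI Suc_pred' leI le_less_trans less_Suc_eq_le zero_le)
  have "M = card (\<Union>X\<in>Pow {1..\<kappa>}. colored_stars c X)"
  proof -
    have "(\<Union>X\<in>Pow {1..\<kappa>}. colored_stars c X) = {..<M}"
      using child_colors_star_subset unfolding colored_stars_def by auto
    then show ?thesis by simp
  qed
  also have "\<dots> \<le> (\<Sum>X\<in>Pow {1..\<kappa>}. card (colored_stars c X))"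
    by (rule card_UN_le) simp
  also have "\<dots> \<le> (\<Sum>X\<in>Pow {1..\<kappa>}. 3 * \<Delta> - 1)" using small by (intro sum_mono) auto
  also have "\<dots> = 2 ^ \<kappa> * (3 * \<Delta> - 1)" by (simp add: card_Pow)
  also have "\<dots> < 2 ^ \<kappa> * (3 * \<Delta>)" using Delta by (intro mult_strict_left_mono) auto
  also have "\<dots> = M" by (simp add: M_def mult.commute)
  finally show False by simp
qed

text \<open>The hub edge to a star with color set \<open>X\<close> avoids \<open>X\<close>, and hub
  edges have distinct colors, so there are at most \<open>\<kappa> - (\<Delta> - 1)\<close> of them.
  The star \<open>r\<close> gives \<open>X\<close> its size even when \<open>T\<close> is
  empty.\<close>

lemma card_attached_less:
  assumes all: "\<And>r. r \<in> T \<Longrightarrow> child_colors c r = X" and X: "r < M" "child_colors c r = X"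
  shows "card T < \<Delta>"
proof -
  have col: "\<exists>k. c (hub, t) = Some k" if "t \<in> T" for t
    using that dom_c unfolding attached_def by blast
  have "inj_on (\<lambda>t. the (c (hub, t))) T"
  proof (rule inj_onI)
    fix s t assume st: "s \<in> T" "t \<in> T" "the (c (hub, s)) = the (c (hub, t))"
    then obtain k where "c (hub, s) = Some k" "c (hub, t) = Some k" using col by fastforce
    then show "s = t"
      using partial_proper_unique[OF proper_c, of hub "(hub, s)" "(hub, t)"]
      by (simp add: incident_def)
  qed
  moreover have "(\<lambda>t. the (c (hub, t))) ` T \<subseteq> {1..\<kappa>} - X"
  proof
    fix k assume "k \<in> (\<lambda>t. the (c (hub, t))) ` T"
    then obtain t where t: "t \<in> T" "c (hub, t) = Some k" using col by fastforce
    have "k \<notin> child_colors c t"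
    proof
      assume "k \<in> child_colors c t"
      then obtain l where "c (t, l) = Some k" unfolding child_colors_def by auto
      then have "(t, l) = (hub, t)"
        using partial_proper_unique[OF proper_c, of t "(t, l)" "(hub, t)"] t
        by (simp add: incident_def)
      then show False using t(1) T M_le_hub by auto
    qed
    then show "k \<in> {1..\<kappa>} - X" using all[OF t(1)] partial_proper_range[OF proper_c t(2)] by blast
  qed
  ultimately have "card T \<le> card ({1..\<kappa>} - X)" by (metis card_inj_on_le finite_Diff finite_atLeastAtMost)
  also have "\<dots> = \<Delta> - 1"
    using X child_colors_star_subset[of r] card_child_colors_star[OF X(1)] Delta
    by (auto simp: card_Diff_subset finite_subset)
  finally show ?thesis using Delta by simp
qed

text \<open>If all stars using \<open>X\<close> are attached, there are at most \<Delta> of them,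
  and apart from \<open>- card T\<close> they contribute at most
  \<open>2 * \<Delta> + \<Delta>\<close> to the advantage. A popular set contributes
  \<open>3 * \<Delta>\<close> through the last summand alone, so switching loses nothing, and some
  of its stars are unattached.\<close>

lemma better_target:
  assumes "card T \<le> \<Delta>"
  shows "\<exists>X' r. advantage c X T \<le> advantage c X' T \<and> r < M \<and> r \<notin> T \<and> child_colors c r = X'"
proof (cases "colored_stars c X \<subseteq> T")
  case False
  then show ?thesis unfolding colored_stars_def by blast
next
  case True
  have finT: "finite T" by (rule finite_subset[OF T]) simp
  obtain X' where X': "card (colored_stars c X') \<ge> 3 * \<Delta>" by (rule exE[OF popular_color_set])
  have "\<not> colored_stars c X' \<subseteq> T"
  proof
    assume "colored_stars c X' \<subseteq> T"
    then have "3 * \<Delta> \<le> card T" using X' card_mono[OF finT] by (meson order_trans)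
    then show False using assms Delta by simp
  qed
  then obtain r where r: "r < M" "r \<notin> T" "child_colors c r = X'"
    unfolding colored_stars_def by blast
  have "card (colored_stars c X) \<le> \<Delta>" using card_mono[OF finT True] assms by simp
  moreover have "card (T \<inter> colored_stars c X) \<le> card T" using finT by (intro card_mono) auto
  ultimately have "advantage c X T \<le> advantage c X' T"
    using X' assms unfolding advantage_def by linarith
  then show ?thesis using r by blast
qed

end

text \<open>Star edges are colored before and after the update, so a star whose color set changes
  contains a recolored edge, and different stars contain different ones. Each such star costs at
  most 2 in the first summand and 1 in the last.\<close>

lemma advantage_recourse:
  assumes T: "T \<subseteq> {..<M}" "proper_edge_coloring \<kappa> (attached T) c"
    and T': "T' \<subseteq> {..<M}" "proper_edge_coloring \<kappa> (attached T') c'"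
  shows "advantage c X S \<le> advantage c' X S + 3 * int (recourse c c')"
proof -
  let ?D = "{r \<in> {..<M}. child_colors c r \<noteq> child_colors c' r}"
  let ?F = "{e \<in> dom c \<inter> dom c'. c e \<noteq> c' e}"
  have fin: "finite ?F" using finite_attached[OF T(1)] dom_c[OF T] by simp
  have "?D \<subseteq> fst ` ?F"
  proof
    fix r assume "r \<in> ?D"
    then obtain l where l: "(r, l) \<in> star_edges" "c (r, l) \<noteq> c' (r, l)"
      using child_colors_star[OF T] child_colors_star[OF T'] 
      by (smt (verit) image_cong lessThan_iff mem_Collect_eq)
    then have "(r, l) \<in> ?F" using dom_c[OF T] dom_c[OF T'] by (auto simp: attached_def)
    then show "r \<in> fst ` ?F" by force
  qed
  then have "card ?D \<le> card (fst ` ?F)" using fin by (intro card_mono) auto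
  also have "\<dots> \<le> recourse c c'" unfolding recourse_def by (rule card_image_le[OF fin])
  finally have D: "card ?D \<le> recourse c c'" .
  have finD: "finite ?D" by simp
  have sub: "colored_stars c X \<subseteq> colored_stars c' X \<union> ?D" unfolding colored_stars_def by auto
  have "card (colored_stars c X) \<le> card (colored_stars c' X \<union> ?D)"
    using sub finD finite_colored_stars by (intro card_mono) auto
  also have "\<dots> \<le> card (colored_stars c' X) + card ?D" by (rule card_Un_le)
  finally have 1: "card (colored_stars c X) \<le> card (colored_stars c' X) + recourse c c'" 
    using D by simp
  have "card (S \<inter> colored_stars c X) \<le> card ((S \<inter> colored_stars c' X) \<union> ?D)"
    using sub finD finite_colored_stars by (intro card_mono) auto
  also have "\<dots> \<le> card (S \<inter> colored_stars c' X) + card ?D" by (rule card_Un_le)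
  finally have 2: "card (S \<inter> colored_stars c X) \<le> card (S \<inter> colored_stars c' X) + recourse c c'"
    using D by simp
  show ?thesis using 1 2 unfolding advantage_def by linarith
qed

section \<open>The moves of the adversary\<close>

definition position :: "nat update list \<Rightarrow> nat set \<Rightarrow> bool" where
  "position \<sigma> T \<longleftrightarrow> legal_sequence \<Delta> {..<n} \<sigma> \<and> forest_of \<sigma> = attached T \<and> T \<subseteq> {..<M} \<and> card T \<le> \<Delta>"

lemma position_proper: "position \<sigma> T \<Longrightarrow> proper_edge_coloring \<kappa> (attached T) (alg \<sigma>)"
  using alg unfolding position_def maintains_proper_def by metis

lemma position_delete:
  assumes "position \<sigma> T" "b \<in> T"
  shows "position (\<sigma> @ [Delete hub b]) (T - {b})"
proof -
  have T: "T \<subseteq> {..<M}" "card T \<le> \<Delta>" using assms unfolding position_def by auto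
  have "attached T - {(hub, b)} = attached (T - {b})"
    using star_edgesD[of hub b] M_le_hub unfolding attached_def by auto
  moreover have c: "card (T - {b}) \<le> \<Delta>" using T(2) by (meson card_Diff1_le order_trans)
  moreover have "degree (attached (T - {b})) x \<le> \<Delta>" for x
    using degree_attached[OF _ c] T by blast
  moreover have "(hub, b) \<in> attached T" using assms(2) by (simp add: attached_def)
  ultimately show ?thesis
    using assms unfolding position_def by (auto simp: legal_sequence_snoc)
qed

lemma position_insert:
  assumes "position \<sigma> T" "r < M" "r \<notin> T" "card T < \<Delta>"
  shows "position (\<sigma> @ [Insert hub r]) (insert r T)"
proof -
  have T: "T \<subseteq> {..<M}" using assms unfolding position_def by auto
  have finT: "finite T" by (rule finite_subset[OF T]) simp
  have c: "card (insert r T) \<le> \<Delta>" using assms finT by simp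
  have "is_root (attached T) r"
    using assms(2,3) star_edgesD unfolding is_root_def attached_def by fastforce
  \<comment> \<open>The unattached star of \<open>r\<close> is a tree by itself, so no edge crosses
    the boundary of its complement.\<close>
  moreover have "\<not> same_tree (attached T) hub r"
  proof (rule not_same_tree[where S = "- insert r {l. (r, l) \<in> star_edges}"])
    fix a b assume "(a, b) \<in> attached T"
    then consider "(a, b) \<in> star_edges" | "a = hub" "b \<in> T" unfolding attached_def by auto
    then show "a \<in> - insert r {l. (r, l) \<in> star_edges} \<longleftrightarrow> b \<in> - insert r {l. (r, l) \<in> star_edges}"
    proof cases
      case 1
      have "b \<noteq> r" "(r, a) \<notin> star_edges"
        using star_edgesD[OF 1] star_edgesD[of r a] assms(2) by auto
      moreover have "(r, b) \<in> star_edges \<longleftrightarrow> a = r" using 1 by (auto simp: star_edges_def)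
      ultimately show ?thesis by auto
    next
      case 2
      then show ?thesis using assms(2,3) T star_edgesD[of r] M_le_hub by fastforce
    qed
  next
    show "hub \<in> - insert r {l. (r, l) \<in> star_edges}"
      using assms(2) star_edgesD[of r] M_le_hub by fastforce
  qed simp
  ultimately have "admissible {..<n} (attached T) (Insert hub r)"
    using assms(2) M_le_hub hub_less by simp
  moreover have "insert (hub, r) (attached T) = attached (insert r T)"
    unfolding attached_def by auto
  moreover have "degree (attached (insert r T)) x \<le> \<Delta>" for x
    using degree_attached[OF _ c] T assms(2) by blast
  ultimately show ?thesis
    using assms(1,2) c unfolding position_def by (auto simp: legal_sequence_snoc)
qed

lemma adversary_step:
  assumes pos: "position \<sigma> T"
  shows "\<exists>u T' X'. position (\<sigma> @ [u]) T' \<and>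
    advantage (alg \<sigma>) X T + 1 \<le> advantage (alg (\<sigma> @ [u])) X' T' + 3 * int (recourse (alg \<sigma>) (alg (\<sigma> @ [u])))"
proof -
  let ?c = "alg \<sigma>"
  have T: "T \<subseteq> {..<M}" "card T \<le> \<Delta>" using pos unfolding position_def by auto
  have finT: "finite T" by (rule finite_subset[OF T(1)]) simp
  note c = position_proper[OF pos]
  obtain X' r where X': "advantage ?c X T \<le> advantage ?c X' T"
    and r: "r < M" "r \<notin> T" "child_colors ?c r = X'"
    using better_target[OF T(1) c T(2)] by blast
  \<comment> \<open>First the coloring is held fixed. Detaching a star with a wrong color set lowers
    \<open>card T\<close> by one. If there is none, attaching \<open>r\<close> adds
    \<open>2 - 1\<close>, and by \<open>card_attached_less\<close> the hub has room for it.\<close>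
  have "\<exists>u T'. position (\<sigma> @ [u]) T' \<and> advantage ?c X' T + 1 = advantage ?c X' T'"
  proof (cases "\<exists>b\<in>T. child_colors ?c b \<noteq> X'")
    case True
    then obtain b where b: "b \<in> T" "child_colors ?c b \<noteq> X'" by auto
    have "(T - {b}) \<inter> colored_stars ?c X' = T \<inter> colored_stars ?c X'"
      using b by (auto simp: colored_stars_def)
    moreover have "int (card T) = int (card (T - {b})) + 1"
      using card_Suc_Diff1[OF finT b(1)] by linarith
    ultimately have "advantage ?c X' T + 1 = advantage ?c X' (T - {b})"
      unfolding advantage_def by simp
    then show ?thesis using position_delete[OF pos b(1)] by blast
  next
    case False
    have "card T < \<Delta>" using card_attached_less[OF T(1) c _ r(1,3)] False by blast
    moreover have "insert r T \<inter> colored_stars ?c X' = insert r (T \<inter> colored_stars ?c X')"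
      using r by (auto simp: colored_stars_def)
    then have "advantage ?c X' T + 1 = advantage ?c X' (insert r T)"
      using r finT unfolding advantage_def by simp
    ultimately show ?thesis using position_insert[OF pos r(1,2)] by blast
  qed
  then obtain u T' where u: "position (\<sigma> @ [u]) T'"
    "advantage ?c X' T + 1 = advantage ?c X' T'" by blast
  have T': "T' \<subseteq> {..<M}" using u(1) unfolding position_def by simp
  \<comment> \<open>Now the reaction of the algorithm is charged to its recourse.\<close>
  have "advantage ?c X T + 1
      \<le> advantage (alg (\<sigma> @ [u])) X' T' + 3 * int (recourse ?c (alg (\<sigma> @ [u])))"
    using advantage_recourse[OF T(1) c T' position_proper[OF u(1)], of X' T'] u(2) X' by linarith
  then show ?thesis using u(1) by blast
qed

text \<open>The \<open>hub - M\<close> updates that build the stars come first; the advantage is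
  then nonnegative because no star is attached.\<close>

lemma adversary:
  "\<exists>\<sigma> T X. position \<sigma> T \<and> length \<sigma> = (hub - M) + m \<and>
    int m \<le> advantage (alg \<sigma>) X T + 3 * int (total_recourse alg \<sigma>)"
proof (induction m)
  case 0
  have "position (build hub) {}" using build_hub by (simp add: position_def)
  moreover have "length (build hub) = hub - M" by (simp add: build_def)
  ultimately show ?case by (force simp: advantage_def)
next
  case (Suc m)
  then obtain \<sigma> T X where IH: "position \<sigma> T" "length \<sigma> = (hub - M) + m"
    "int m \<le> advantage (alg \<sigma>) X T + 3 * int (total_recourse alg \<sigma>)" by blast
  obtain u T' X' where u: "position (\<sigma> @ [u]) T'"
    "advantage (alg \<sigma>) X T + 1 \<le> advantage (alg (\<sigma> @ [u])) X' T' + 3 * int (recourse (alg \<sigma>) (alg (\<sigma> @ [u])))"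
    using adversary_step[OF IH(1)] by blast
  have "int (Suc m) \<le> advantage (alg (\<sigma> @ [u])) X' T' + 3 * int (total_recourse alg (\<sigma> @ [u]))"
    using u(2) IH(3) by (simp add: total_recourse_snoc)
  moreover have "length (\<sigma> @ [u]) = (hub - M) + Suc m" using IH(2) by simp
  ultimately show ?case using u(1) by blast
qed

lemma amortized_recourse_adversary:
  "\<exists>\<sigma>. legal_sequence \<Delta> {..<n} \<sigma> \<and> length \<sigma> \<ge> L \<and>
     amortized_recourse (length \<sigma>) (\<lambda>i. alg (take i \<sigma>)) \<ge> 1 / 12"
proof -
  \<comment> \<open>The advantage is at most \<open>4 * \<Delta>\<close>, so
    \<open>12 * total_recourse alg \<sigma>\<close> is at least
    \<open>4 * m - 16 * \<Delta>\<close>. This exceeds the length \<open>(hub - M) + m\<close>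
    because \<open>3 * m \<ge> (hub - M) + 16 * \<Delta>\<close>. The summand \<open>L\<close> makes
    the sequence long enough.\<close>
  define m where "m = L + (hub - M) + 16 * \<Delta>"
  obtain \<sigma> T X where s: "position \<sigma> T" "length \<sigma> = (hub - M) + m"
    "int m \<le> advantage (alg \<sigma>) X T + 3 * int (total_recourse alg \<sigma>)"
    using adversary by blast
  have finT: "finite T" "card T \<le> \<Delta>" using s(1) finite_subset unfolding position_def by auto
  then have "card (T \<inter> colored_stars (alg \<sigma>) X) \<le> card T" by (intro card_mono) auto
  then have "advantage (alg \<sigma>) X T \<le> 4 * int \<Delta>"
    using finT(2) unfolding advantage_def by linarith
  then have "length \<sigma> \<le> 12 * total_recourse alg \<sigma>"
    using s(2,3) unfolding m_def by linarith
  then have "real (length \<sigma>) \<le> 12 * real (total_recourse alg \<sigma>)"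
    by (metis of_nat_le_iff of_nat_mult of_nat_numeral)
  moreover have "length \<sigma> > 0" using s(2) Delta unfolding m_def by simp
  ultimately have "amortized_recourse (length \<sigma>) (\<lambda>i. alg (take i \<sigma>)) \<ge> 1 / 12"
    unfolding amortized_recourse_def total_recourse_def by (simp add: le_divide_eq)
  moreover have "legal_sequence \<Delta> {..<n} \<sigma>" using s(1) unfolding position_def by simp
  moreover have "length \<sigma> \<ge> L" using s(2) unfolding m_def by simp
  ultimately show ?thesis by blast
qed

end

theorem theorem2p7:
  shows
   "(\<exists>C::real. \<forall>\<Delta>::nat. \<Delta> \<ge> 3 \<longrightarrow>
       (\<forall>(n::nat) (\<sigma>::nat update list). legal_sequence \<Delta> {..<n} \<sigma> \<longrightarrow>
          cp_maintains_proper (2 * \<Delta> - 2) \<sigma> \<and>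
          (\<forall>\<gamma>. cp_run (2 * \<Delta> - 2) \<sigma> \<gamma> \<longrightarrow> amortized_recourse (length \<sigma>) \<gamma> \<le> C)))
    \<and>
    (\<exists>c::real. c > 0 \<and> (\<forall>\<Delta>::nat. \<Delta> \<ge> 3 \<longrightarrow>
       (\<exists>N::nat. \<forall>n \<ge> N. \<forall>alg::nat det_algorithm.
          maintains_proper (2 * \<Delta> - 2) \<Delta> {..<n} alg \<longrightarrow>
          (\<forall>L::nat. \<exists>\<sigma>. legal_sequence \<Delta> {..<n} \<sigma> \<and> length \<sigma> \<ge> L \<and>
             amortized_recourse (length \<sigma>) (\<lambda>i. alg (take i \<sigma>)) \<ge> c))))"
proof (intro conjI)
  show "\<exists>C::real. \<forall>\<Delta>::nat. \<Delta> \<ge> 3 \<longrightarrow>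
       (\<forall>(n::nat) (\<sigma>::nat update list). legal_sequence \<Delta> {..<n} \<sigma> \<longrightarrow>
          cp_maintains_proper (2 * \<Delta> - 2) \<sigma> \<and>
          (\<forall>\<gamma>. cp_run (2 * \<Delta> - 2) \<sigma> \<gamma> \<longrightarrow> amortized_recourse (length \<sigma>) \<gamma> \<le> C))"
    using cp_maintains_proper_legal amortized_recourse_cp_run by (intro exI[of _ 7]) blast
  \<comment> \<open>The threshold for \<open>n\<close> counts all vertices of the stars and, by the
    \<open>Suc\<close>, the hub.\<close>
  have "\<exists>\<sigma>. legal_sequence \<Delta> {..<n} \<sigma> \<and> length \<sigma> \<ge> L \<and>
      amortized_recourse (length \<sigma>) (\<lambda>i. alg (take i \<sigma>)) \<ge> 1 / 12"
    if "\<Delta> \<ge> 3" "n \<ge> Suc (3 * \<Delta> * 2 ^ (2 * \<Delta> - 2) * \<Delta>)"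
      "maintains_proper (2 * \<Delta> - 2) \<Delta> {..<n} alg" for \<Delta> n L :: nat and alg :: "nat det_algorithm"
  proof -
    interpret star_adversary \<Delta> n alg using that by unfold_locales auto
    show ?thesis by (rule amortized_recourse_adversary)
  qed
  then show "\<exists>c::real. c > 0 \<and> (\<forall>\<Delta>::nat. \<Delta> \<ge> 3 \<longrightarrow>
       (\<exists>N::nat. \<forall>n \<ge> N. \<forall>alg::nat det_algorithm.
          maintains_proper (2 * \<Delta> - 2) \<Delta> {..<n} alg \<longrightarrow>
          (\<forall>L::nat. \<exists>\<sigma>. legal_sequence \<Delta> {..<n} \<sigma> \<and> length \<sigma> \<ge> L \<and>
             amortized_recourse (length \<sigma>) (\<lambda>i. alg (take i \<sigma>)) \<ge> c)))"
    by (intro exI[of _ "1 / 12 :: real"] conjI, simp) meson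
qed

end
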